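(* Let $\Omega$ be a bounded domain in $\mathbb{R}^n$, let $F\in (L^2(\Omega))^n$ and $H\in L^{2}(\Omega)$, and let $a\in L^2(\Omega)$ be a positive function. Consider the primal problem $$(P)\qquad \inf_{u\in \mathring{H}^1(\Omega)} \int_\Omega \big(a|Du+F|+Hu\big)\,dx$$ and its dual problem $$(D)\qquad \sup\{\langle F,b\rangle : b\in\mathcal{D}_0,\ |b|\le a \text{ a.e. in } \Omega\}.$$ Then the duality gap is zero and the dual problem $(D)$ has a solution, i.e. there exists a vector field $N\in\mathcal{D}_0$ with $|N|\le a$ a.e. in $\Omega$ such that $$\inf_{u\in\mathring{H}^1(\Omega)}\int_\Omega \big(a|Du+F|+Hu\big)\,dx=\langle F,N\rangle .$$ Moreover, $$\frac{Du+F}{|Du+F|}=N\qquad |Du+F|\text{-a.e. in }\Omega$$ for any minimizer $u$ of $(P)$.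
   Context: $\mathring{H}^1(\Omega)=\{u\in H^1(\Omega):\int_\Omega u\,dx=0\}$, and $Du$ denotes the gradient of $u$. $\mathcal{D}_0=\{b\in(L^2(\Omega))^n:\int_\Omega(\nabla u\cdot b+Hu)\,dx=0 \text{ for all } u\in\mathring{H}^1(\Omega)\}$. $\langle F,b\rangle=\int_\Omega F\cdot b\,dx$. "$|Du+F|$-a.e." means almost everywhere with respect to the measure $|Du+F|$.
   Formalization: Existence of N is stated when the infimum of (P) is not −∞ (it can be −∞, and then no N exists; the zero gap is kept in all cases), and the last formula is corrected to a(Du+F)/|Du+F| = N, since the printed one contradicts |N| ≤ a when a < 1. *)

theory Defs
  imports "HOL-Analysis.Analysis"
begin

definition L2 :: "(real^'n) set \<Rightarrow> (real^'n \<Rightarrow> 'b::euclidean_space) set" where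
  "L2 \<Omega> = {f \<in> borel_measurable (lebesgue_on \<Omega>).
            integrable (lebesgue_on \<Omega>) (\<lambda>x. (norm (f x))\<^sup>2)}"

text \<open>\<open>C_k k f\<close>: \<open>f\<close> is \<open>k\<close> times continuously differentiable on the whole space.\<close>

primrec C_k :: "nat \<Rightarrow> (real^'n \<Rightarrow> real) \<Rightarrow> bool" where
  "C_k 0 f = continuous_on UNIV f"
| "C_k (Suc k) f = (\<exists>g. (\<forall>x. GDERIV f x :> g x) \<and> (\<forall>i. C_k k (\<lambda>x. g x $ i)))"

definition test_function :: "(real^'n) set \<Rightarrow> (real^'n \<Rightarrow> real) \<Rightarrow> bool" where
  "test_function \<Omega> \<phi> \<longleftrightarrow> (\<forall>k. C_k k \<phi>) \<and>
     compact (closure {x. \<phi> x \<noteq> 0}) \<and> closure {x. \<phi> x \<noteq> 0} \<subseteq> \<Omega>"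

text \<open>\<open>u\<close> belongs to \<open>H\<^sup>1(\<Omega>)\<close> and \<open>G\<close> represents its weak gradient. The representative is unique
  only up to null sets, so, as with \<^const>\<open>has_derivative\<close>, it is a relation; the integrals
  below do not depend on the choice of \<open>G\<close>.\<close>

definition has_H1_gradient ::
    "(real^'n) set \<Rightarrow> (real^'n \<Rightarrow> real) \<Rightarrow> (real^'n \<Rightarrow> real^'n) \<Rightarrow> bool" where
  "has_H1_gradient \<Omega> u G \<longleftrightarrow> u \<in> L2 \<Omega> \<and> G \<in> L2 \<Omega> \<and>
     (\<forall>\<phi> g. test_function \<Omega> \<phi> \<longrightarrow> (\<forall>x. GDERIV \<phi> x :> g x) \<longrightarrow>
        (\<integral>x. u x *\<^sub>R g x \<partial>(lebesgue_on \<Omega>)) = - (\<integral>x. \<phi> x *\<^sub>R G x \<partial>(lebesgue_on \<Omega>)))"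

definition H1 :: "(real^'n) set \<Rightarrow> (real^'n \<Rightarrow> real) set" where
  "H1 \<Omega> = {u. \<exists>G. has_H1_gradient \<Omega> u G}"

definition H1_mean_zero :: "(real^'n) set \<Rightarrow> (real^'n \<Rightarrow> real) set" where
  "H1_mean_zero \<Omega> = {u \<in> H1 \<Omega>. (\<integral>x. u x \<partial>(lebesgue_on \<Omega>)) = 0}"

definition primal_energy ::
    "(real^'n) set \<Rightarrow> (real^'n \<Rightarrow> real) \<Rightarrow> (real^'n \<Rightarrow> real^'n) \<Rightarrow> (real^'n \<Rightarrow> real)
     \<Rightarrow> (real^'n \<Rightarrow> real) \<Rightarrow> (real^'n \<Rightarrow> real^'n) \<Rightarrow> real" where
  "primal_energy \<Omega> a F H u Du =
     (\<integral>x. a x * norm (Du x + F x) + H x * u x \<partial>(lebesgue_on \<Omega>))"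

text \<open>The infimum and the supremum are taken in the extended reals: the primal energy may be
  unbounded below, and then the dual problem has no admissible field.\<close>

definition primal_value ::
    "(real^'n) set \<Rightarrow> (real^'n \<Rightarrow> real) \<Rightarrow> (real^'n \<Rightarrow> real^'n) \<Rightarrow> (real^'n \<Rightarrow> real) \<Rightarrow> ereal" where
  "primal_value \<Omega> a F H =
     Inf {ereal (primal_energy \<Omega> a F H u Du) | u Du.
            u \<in> H1_mean_zero \<Omega> \<and> has_H1_gradient \<Omega> u Du}"

definition primal_minimizer ::
    "(real^'n) set \<Rightarrow> (real^'n \<Rightarrow> real) \<Rightarrow> (real^'n \<Rightarrow> real^'n) \<Rightarrow> (real^'n \<Rightarrow> real)
     \<Rightarrow> (real^'n \<Rightarrow> real) \<Rightarrow> (real^'n \<Rightarrow> real^'n) \<Rightarrow> bool" where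
  "primal_minimizer \<Omega> a F H u Du \<longleftrightarrow>
     u \<in> H1_mean_zero \<Omega> \<and> has_H1_gradient \<Omega> u Du \<and>
     (\<forall>v Dv. v \<in> H1_mean_zero \<Omega> \<longrightarrow> has_H1_gradient \<Omega> v Dv \<longrightarrow>
        primal_energy \<Omega> a F H u Du \<le> primal_energy \<Omega> a F H v Dv)"

definition pairing ::
    "(real^'n) set \<Rightarrow> (real^'n \<Rightarrow> real^'n) \<Rightarrow> (real^'n \<Rightarrow> real^'n) \<Rightarrow> real" where
  "pairing \<Omega> F b = (\<integral>x. F x \<bullet> b x \<partial>(lebesgue_on \<Omega>))"

definition D0 :: "(real^'n) set \<Rightarrow> (real^'n \<Rightarrow> real) \<Rightarrow> (real^'n \<Rightarrow> real^'n) set" where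
  "D0 \<Omega> H = {b \<in> L2 \<Omega>. \<forall>u Du. u \<in> H1_mean_zero \<Omega> \<longrightarrow> has_H1_gradient \<Omega> u Du \<longrightarrow>
     (\<integral>x. Du x \<bullet> b x + H x * u x \<partial>(lebesgue_on \<Omega>)) = 0}"

definition dual_admissible ::
    "(real^'n) set \<Rightarrow> (real^'n \<Rightarrow> real) \<Rightarrow> (real^'n \<Rightarrow> real) \<Rightarrow> (real^'n \<Rightarrow> real^'n) set" where
  "dual_admissible \<Omega> a H = {b \<in> D0 \<Omega> H. AE x in lebesgue_on \<Omega>. norm (b x) \<le> a x}"

definition dual_value ::
    "(real^'n) set \<Rightarrow> (real^'n \<Rightarrow> real) \<Rightarrow> (real^'n \<Rightarrow> real^'n) \<Rightarrow> (real^'n \<Rightarrow> real) \<Rightarrow> ereal" where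
  "dual_value \<Omega> a F H = (SUP b\<in>dual_admissible \<Omega> a H. ereal (pairing \<Omega> F b))"

definition norm_measure ::
    "(real^'n) set \<Rightarrow> (real^'n \<Rightarrow> real^'n) \<Rightarrow> (real^'n) measure" where
  "norm_measure \<Omega> V = density (lebesgue_on \<Omega>) (\<lambda>x. ennreal (norm (V x)))"

end

theory Submission
  imports Defs "HOL-Library.Function_Algebras"
begin

text \<open>Write \<open>p V = \<integral>a\<bar>V\<bar>\<close>. The primal problem minimises \<open>p (Du + F) + \<integral>H u\<close>, a sublinear functional of
\<open>Du + F\<close> plus a linear one of \<open>u\<close>, over a linear space of pairs \<open>(u, Du)\<close>. If its infimum \<open>m\<close> is
finite, the inequality \<open>m \<le> p (Du + F) + \<integral>H u\<close> says that \<open>p\<close> is compatible with the prescriptions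
\<open>l (Du) = - \<integral>H u\<close> and \<open>l F \<ge> m\<close>, so by Hahn--Banach (\<open>sublinear_duality\<close>) some linear
\<open>l \<le> p\<close> satisfies them. As \<open>p\<close> is the \<open>L\<^sup>1\<close> norm of the finite measure \<open>a dx\<close>, the functional is
\<open>l V = \<integral>V \<bullet> h a dx\<close> with \<open>\<bar>h\<bar> \<le> 1\<close> (\<open>L1_functional_representation\<close>). The field \<open>N = a h\<close> then satisfies
\<open>\<bar>N\<bar> \<le> a\<close>, the prescription on gradients is membership in \<open>D0\<close>, and \<open>\<integral>F \<bullet> N \<ge> m\<close>
(\<open>strong_duality\<close>).

For every admissible \<open>b\<close> and every competitor, the primal energy minus \<open>\<integral>F \<bullet> b\<close> equals
\<open>\<integral>(a \<bar>Du + F\<bar> - (Du + F) \<bullet> b)\<close>, whose integrand is nonnegative (\<open>duality_defect\<close>). Hence the dual value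
never exceeds the primal one, which settles the case \<open>m = -\<infinity>\<close> and shows that \<open>N\<close> is optimal. At a
minimizer the integral for \<open>b = N\<close> vanishes, and equality in Cauchy--Schwarz gives the
extremality relation (\<open>equality_in_weak_duality\<close>).\<close>

section \<open>Linear functionals below a sublinear one\<close>

definition sublinear_on :: "'v::real_vector set \<Rightarrow> ('v \<Rightarrow> real) \<Rightarrow> bool" where
  "sublinear_on S p \<longleftrightarrow>
     (\<forall>v\<in>S. \<forall>w\<in>S. p (v + w) \<le> p v + p w) \<and> (\<forall>v\<in>S. \<forall>c\<ge>0. p (c *\<^sub>R v) = c * p v)"

lemma sublinear_onD:
  assumes "sublinear_on S p"
  shows "v \<in> S \<Longrightarrow> w \<in> S \<Longrightarrow> p (v + w) \<le> p v + p w"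
    and "v \<in> S \<Longrightarrow> 0 \<le> c \<Longrightarrow> p (c *\<^sub>R v) = c * p v"
  using assms by (auto simp: sublinear_on_def)

lemma sublinear_onI:
  assumes S: "subspace S"
    and add: "\<And>v w. v \<in> S \<Longrightarrow> w \<in> S \<Longrightarrow> p (v + w) \<le> p v + p w"
    and zero: "p 0 = 0"
    and scale: "\<And>v c. v \<in> S \<Longrightarrow> 0 < c \<Longrightarrow> p (c *\<^sub>R v) \<le> c * p v"
  shows "sublinear_on S p"
  unfolding sublinear_on_def
proof (intro conjI ballI allI impI add)
  fix v and c :: real
  assume v: "v \<in> S" and c: "0 \<le> c"
  show "p (c *\<^sub>R v) = c * p v"
  proof (cases "c = 0")
    case False
    with c have c0: "0 < c" by simp
    have "p v = p (inverse c *\<^sub>R (c *\<^sub>R v))" using c0 by simp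
    also have "\<dots> \<le> inverse c * p (c *\<^sub>R v)"
      using c0 v S by (intro scale) (auto simp: subspace_def)
    finally have "c * p v \<le> p (c *\<^sub>R v)"
      using c0 by (simp add: field_simps)
    with scale[OF v c0] show ?thesis by simp
  qed (simp add: zero)
qed

lemma sublinear_on_zero:
  assumes "subspace S" "sublinear_on S p"
  shows "p 0 = 0"
  using sublinear_onD(2)[OF assms(2), of 0 0] assms(1) by (simp add: subspace_def)

lemma sublinear_on_lower:
  assumes "subspace S" "sublinear_on S p" "v \<in> S"
  shows "- p (- v) \<le> p v"
  using sublinear_onD(1)[OF assms(2), of v "- v"] sublinear_on_zero[OF assms(1,2)] assms(1,3)
  by (simp add: subspace_neg)

text \<open>A linear \<open>l\<close> has \<open>0 \<le> l w + r\<close> as soon as \<open>l (- w) \<le> r\<close>, so \<open>p\<close> is pushed down, staying sublinear,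
until a bound by it enforces this on the whole cone: \<open>g v\<close> is the infimum of \<open>p (v + w) + r\<close>
over \<open>(w, r)\<close> in \<open>C\<close>.
The infimum is finite because \<open>p (v + w) + r \<ge> p w + r - p (- v) \<ge> - p (- v)\<close>. Taking
\<open>(w, r) = (0, 0)\<close> gives \<open>g \<le> p\<close>, and taking \<open>v = - w\<close> gives \<open>g (- w) \<le> r\<close>.
The value \<open>0\<close> outside \<open>S\<close> lets functionals on \<open>S\<close> be compared as total functions.\<close>

lemma sublinear_lower_by_cone:
  fixes p :: "'v::real_vector \<Rightarrow> real" and C :: "('v \<times> real) set"
  assumes S: "subspace S" and p: "sublinear_on S p"
    and C: "convex_cone C" and CS: "\<And>w r. (w, r) \<in> C \<Longrightarrow> w \<in> S"
    and nonneg: "\<And>w r. (w, r) \<in> C \<Longrightarrow> 0 \<le> p w + r"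
  obtains g where "sublinear_on S g" "\<And>v. v \<notin> S \<Longrightarrow> g v = 0"
    "\<And>v w r. v \<in> S \<Longrightarrow> (w, r) \<in> C \<Longrightarrow> g v \<le> p (v + w) + r"
proof -
  define g where "g v = (if v \<in> S then INF (w, r)\<in>C. p (v + w) + r else 0)" for v
  have C0: "(0, 0) \<in> C"
    using convex_cone_contains_0[OF C] by (simp add: zero_prod_def)
  have bdd: "bdd_below ((\<lambda>(w, r). p (v + w) + r) ` C)" if v: "v \<in> S" for v
  proof (rule bdd_belowI2[where m = "- p (- v)"], clarify)
    fix w r assume wr: "(w, r) \<in> C"
    have "p w \<le> p (v + w) + p (- v)"
      using sublinear_onD(1)[OF p, of "v + w" "- v"] v CS[OF wr] S
      by (simp add: subspace_add subspace_neg)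
    with nonneg[OF wr] show "- p (- v) \<le> p (v + w) + r" by simp
  qed
  have le: "g v \<le> p (v + w) + r" if "v \<in> S" "(w, r) \<in> C" for v w r
    using cINF_lower[OF bdd[OF that(1)] that(2)] that(1) by (simp add: g_def)
  have ge: "m \<le> g v" if "v \<in> S" "\<And>w r. (w, r) \<in> C \<Longrightarrow> m \<le> p (v + w) + r" for v m
    unfolding g_def using that C0 by (auto intro!: cINF_greatest)
  have S0: "0 \<in> S" using S by (simp add: subspace_def)
  have "sublinear_on S g"
  proof (rule sublinear_onI[OF S])
    fix v v' assume v: "v \<in> S" and v': "v' \<in> S"
    have vv': "v + v' \<in> S" using S v v' by (simp add: subspace_add)
    have "g (v + v') - g v' \<le> g v"
    proof (rule ge[OF v])
      fix w r assume wr: "(w, r) \<in> C"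
      have "g (v + v') - (p (v + w) + r) \<le> g v'"
      proof (rule ge[OF v'])
        fix w' r' assume wr': "(w', r') \<in> C"
        have "(w + w', r + r') \<in> C"
          using convex_cone_add[OF C wr wr'] by simp
        then have "g (v + v') \<le> p (v + v' + (w + w')) + (r + r')"
          by (rule le[OF vv'])
        also have "p (v + v' + (w + w')) = p ((v + w) + (v' + w'))"
          by (simp add: algebra_simps)
        also have "\<dots> \<le> p (v + w) + p (v' + w')"
          using sublinear_onD(1)[OF p] S v v' CS[OF wr] CS[OF wr'] by (simp add: subspace_add)
        finally show "g (v + v') - (p (v + w) + r) \<le> p (v' + w') + r'" by simp
      qed
      then show "g (v + v') - g v' \<le> p (v + w) + r" by simp
    qed
    then show "g (v + v') \<le> g v + g v'" by simp
  next
    show "g 0 = 0"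
    proof (rule antisym)
      show "g 0 \<le> 0" using le[OF S0 C0] sublinear_on_zero[OF S p] by simp
      show "0 \<le> g 0" using nonneg by (intro ge S0) simp
    qed
  next
    fix v and c :: real assume v: "v \<in> S" and c: "0 < c"
    have "inverse c * g (c *\<^sub>R v) \<le> g v"
    proof (rule ge[OF v])
      fix w r assume wr: "(w, r) \<in> C"
      have "(c *\<^sub>R w, c * r) \<in> C"
        using convex_cone_scaleR[OF C, of c "(w, r)"] wr c by simp
      then have "g (c *\<^sub>R v) \<le> p (c *\<^sub>R v + c *\<^sub>R w) + c * r"
        using S v by (intro le) (auto simp: subspace_scale)
      also have "\<dots> = c * (p (v + w) + r)"
        using sublinear_onD(2)[OF p, of "v + w" c] S v CS[OF wr] c
        by (simp add: subspace_add scaleR_add_right distrib_left)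
      finally show "inverse c * g (c *\<^sub>R v) \<le> p (v + w) + r"
        using c by (simp add: field_simps)
    qed
    then show "g (c *\<^sub>R v) \<le> c * g v" using c by (simp add: field_simps)
  qed
  with le that show ?thesis by (auto simp: g_def)
qed

text \<open>Zorn's lemma applies to the sublinear functionals below \<open>p\<close>, ordered downwards: they are bounded
below pointwise, since \<open>f v \<ge> - f (- v) \<ge> - p (- v)\<close>, and the pointwise infimum of a chain is again
sublinear.\<close>

lemma minimal_sublinear_exists:
  fixes p :: "'v::real_vector \<Rightarrow> real"
  assumes S: "subspace S" and p: "sublinear_on S p" and p0: "\<And>v. v \<notin> S \<Longrightarrow> p v = 0"
  obtains m where "sublinear_on S m" "\<And>v. v \<notin> S \<Longrightarrow> m v = 0" "\<And>v. m v \<le> p v"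
    "\<forall>f. sublinear_on S f \<longrightarrow> (\<forall>v. v \<notin> S \<longrightarrow> f v = 0) \<longrightarrow> (\<forall>v. f v \<le> m v) \<longrightarrow> f = m"
proof -
  define A where "A = {f. sublinear_on S f \<and> (\<forall>v. v \<notin> S \<longrightarrow> f v = 0) \<and> (\<forall>v. f v \<le> p v)}"
  define P where "P f g \<longleftrightarrow> (\<forall>v. g v \<le> f v)" for f g :: "'v \<Rightarrow> real"
  have "partial_order_on A (relation_of P A)"
    by (rule partial_order_on_relation_ofI)
      (auto simp: P_def fun_eq_iff intro: order_trans antisym)
  moreover have "\<exists>u\<in>A. \<forall>a\<in>K. P a u" if K: "K \<in> Chains (relation_of P A)" for K
  proof (cases "K = {}")
    case True
    then show ?thesis using p p0 by (intro bexI[of _ p]) (auto simp: A_def)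
  next
    case False
    have KA: "f \<in> A" if "f \<in> K" for f
      using K that by (auto simp: Chains_def relation_of_def)
    have chain: "(\<forall>v. f v \<le> g v) \<or> (\<forall>v. g v \<le> f v)" if "f \<in> K" "g \<in> K" for f g
      using K that by (auto simp: Chains_def relation_of_def P_def)
    define u where "u v = (INF f\<in>K. f v)" for v
    have lower: "- p (- v) \<le> f v" if f: "f \<in> K" for f v
    proof (cases "v \<in> S")
      case True
      have "- f (- v) \<le> f v"
        using KA[OF f] True S by (intro sublinear_on_lower[OF S]) (auto simp: A_def)
      moreover have "f (- v) \<le> p (- v)" using KA[OF f] by (simp add: A_def)
      ultimately show ?thesis by simp
    next
      case False
      then have "- v \<notin> S" using subspace_neg[OF S, of "- v"] by auto
      with False KA[OF f] p0 show ?thesis by (simp add: A_def)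
    qed
    have bdd: "bdd_below ((\<lambda>f. f v) ` K)" for v
      using lower by (intro bdd_belowI2)
    have le: "u v \<le> f v" if "f \<in> K" for f v
      unfolding u_def by (rule cINF_lower[OF bdd that])
    have ge: "r \<le> u v" if "\<And>f. f \<in> K \<Longrightarrow> r \<le> f v" for r v
      unfolding u_def using that False by (intro cINF_greatest)
    have sub: "sublinear_on S f" if "f \<in> K" for f using KA[OF that] by (simp add: A_def)
    have "sublinear_on S u"
    proof (rule sublinear_onI[OF S])
      fix v w assume v: "v \<in> S" and w: "w \<in> S"
      have "u (v + w) - u w \<le> u v"
      proof (rule ge)
        fix f assume f: "f \<in> K"
        have "u (v + w) - f v \<le> u w"
        proof (rule ge)
          fix h assume h: "h \<in> K"
          \<comment> \<open>The smaller of \<open>f\<close> and \<open>h\<close> bounds both terms at once; this is where the chain condition enters.\<close>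
          from chain[OF f h] obtain k where k: "k \<in> K" "k v \<le> f v" "k w \<le> h w"
            using f h by auto
          have "u (v + w) \<le> k (v + w)" by (rule le[OF k(1)])
          also have "\<dots> \<le> k v + k w" by (rule sublinear_onD(1)[OF sub[OF k(1)] v w])
          finally show "u (v + w) - f v \<le> h w" using k by simp
        qed
        then show "u (v + w) - u w \<le> f v" by simp
      qed
      then show "u (v + w) \<le> u v + u w" by simp
    next
      have "f 0 = 0" if "f \<in> K" for f by (rule sublinear_on_zero[OF S sub[OF that]])
      then have "(\<lambda>f. f 0) ` K = {0}" using False by (force simp: image_iff)
      then show "u 0 = 0" by (simp add: u_def)
    next
      fix v and c :: real assume v: "v \<in> S" and c: "0 < c"
      have "inverse c * u (c *\<^sub>R v) \<le> u v"
      proof (rule ge)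
        fix f assume f: "f \<in> K"
        have "u (c *\<^sub>R v) \<le> c * f v"
          using le[OF f, of "c *\<^sub>R v"] sublinear_onD(2)[OF sub[OF f] v, of c] c by simp
        then show "inverse c * u (c *\<^sub>R v) \<le> f v" using c by (simp add: field_simps)
      qed
      then show "u (c *\<^sub>R v) \<le> c * u v" using c by (simp add: field_simps)
    qed
    moreover have "u v = 0" if "v \<notin> S" for v
    proof -
      have "f v = 0" if "f \<in> K" for f using KA[OF that] \<open>v \<notin> S\<close> by (simp add: A_def)
      then have "(\<lambda>f. f v) ` K = {0}" using False by (force simp: image_iff)
      then show ?thesis by (simp add: u_def)
    qed
    moreover have "u v \<le> p v" for v
    proof -
      obtain f where f: "f \<in> K" using False by auto
      have "u v \<le> f v" by (rule le[OF f])
      also have "\<dots> \<le> p v" using KA[OF f] by (simp add: A_def)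
      finally show ?thesis .
    qed
    ultimately have "u \<in> A" by (simp add: A_def)
    then show ?thesis using le by (auto simp: P_def)
  qed
  ultimately obtain m where m: "m \<in> A" and min: "\<And>f. f \<in> A \<Longrightarrow> P m f \<Longrightarrow> f = m"
    using predicate_Zorn[of A P] by blast
  show ?thesis
  proof (rule that)
    show "sublinear_on S m" "\<And>v. v \<notin> S \<Longrightarrow> m v = 0" "\<And>v. m v \<le> p v" using m by (auto simp: A_def)
    have "f = m" if f: "sublinear_on S f" "\<forall>v. v \<notin> S \<longrightarrow> f v = 0" "\<forall>v. f v \<le> m v" for f
    proof -
      have "f v \<le> p v" for v
        using f(3) m by (auto simp: A_def intro: order_trans)
      then show "f = m" using f by (intro min) (auto simp: A_def P_def)
    qed
    then show "\<forall>f. sublinear_on S f \<longrightarrow> (\<forall>v. v \<notin> S \<longrightarrow> f v = 0) \<longrightarrow> (\<forall>v. f v \<le> m v) \<longrightarrow> f = m"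
      by blast
  qed
qed

definition linear_functional_on :: "'v::real_vector set \<Rightarrow> ('v \<Rightarrow> real) \<Rightarrow> bool" where
  "linear_functional_on S l \<longleftrightarrow>
     (\<forall>v\<in>S. \<forall>w\<in>S. l (v + w) = l v + l w) \<and> (\<forall>v\<in>S. \<forall>c. l (c *\<^sub>R v) = c * l v)"

text \<open>Lowering \<open>m\<close> by the ray through \<open>(w, - m w)\<close> cannot change a minimal \<open>m\<close>, which forces
\<open>m v \<le> m (v + w) - m w\<close>, the reverse of subadditivity.\<close>

lemma minimal_sublinear_is_linear:
  fixes m :: "'v::real_vector \<Rightarrow> real"
  assumes S: "subspace S" and m: "sublinear_on S m" and m0: "\<And>v. v \<notin> S \<Longrightarrow> m v = 0"
    and min: "\<forall>f. sublinear_on S f \<longrightarrow> (\<forall>v. v \<notin> S \<longrightarrow> f v = 0) \<longrightarrow> (\<forall>v. f v \<le> m v) \<longrightarrow> f = m"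
  shows "linear_functional_on S m"
proof -
  have add: "m (v + w) = m v + m w" if v: "v \<in> S" and w: "w \<in> S" for v w
  proof (rule antisym)
    define C where "C = {(t *\<^sub>R w, - t * m w) | t. 0 \<le> t}"
    have C: "convex_cone C"
      unfolding convex_cone_iff
    proof (intro conjI ballI allI impI)
      show "0 \<in> C" by (auto simp: C_def zero_prod_def intro!: exI[of _ 0])
      fix x y assume "x \<in> C" "y \<in> C"
      then obtain s t where "0 \<le> s" "0 \<le> t" "x = (s *\<^sub>R w, - s * m w)" "y = (t *\<^sub>R w, - t * m w)"
        by (auto simp: C_def)
      then show "x + y \<in> C"
        by (auto simp: C_def algebra_simps intro!: exI[of _ "s + t"])
    next
      fix x and c :: real assume "x \<in> C" "0 \<le> c"
      then obtain s where "0 \<le> s" "x = (s *\<^sub>R w, - s * m w)" by (auto simp: C_def)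
      with \<open>0 \<le> c\<close> show "c *\<^sub>R x \<in> C"
        by (auto simp: C_def algebra_simps intro!: exI[of _ "c * s"])
    qed
    obtain g where g: "sublinear_on S g" "\<And>v. v \<notin> S \<Longrightarrow> g v = 0"
      "\<And>v w r. v \<in> S \<Longrightarrow> (w, r) \<in> C \<Longrightarrow> g v \<le> m (v + w) + r"
    proof (rule sublinear_lower_by_cone[OF S m C])
      show "x \<in> S" if "(x, r) \<in> C" for x r
        using that w S by (auto simp: C_def subspace_scale)
      show "0 \<le> m x + r" if "(x, r) \<in> C" for x r
        using that w by (auto simp: C_def sublinear_onD(2)[OF m])
    qed blast
    have "(0, 0) \<in> C" using convex_cone_contains_0[OF C] by (simp add: zero_prod_def)
    then have "g v \<le> m v" if "v \<in> S" for v using g(3)[OF that, of 0 0] by simp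
    then have "g v \<le> m v" for v using g(2) m0 by (cases "v \<in> S") auto
    then have "g = m" using min g(1,2) by blast
    moreover have "(w, - m w) \<in> C" by (auto simp: C_def intro!: exI[of _ 1])
    ultimately show "m v + m w \<le> m (v + w)" using g(3)[OF v, of w "- m w"] by simp
    show "m (v + w) \<le> m v + m w" by (rule sublinear_onD(1)[OF m v w])
  qed
  have neg: "m (- v) = - m v" if "v \<in> S" for v
    using add[OF that, of "- v"] sublinear_on_zero[OF S m] that S by (simp add: subspace_neg)
  have "m (c *\<^sub>R v) = c * m v" if v: "v \<in> S" for c v
  proof (cases "0 \<le> c")
    case False
    have "m (c *\<^sub>R v) = m (- ((- c) *\<^sub>R v))" by simp
    also have "\<dots> = - m ((- c) *\<^sub>R v)" using v S by (intro neg) (simp add: subspace_scale subspace_neg)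
    also have "\<dots> = c * m v" using sublinear_onD(2)[OF m v, of "- c"] False by simp
    finally show ?thesis .
  qed (simp add: sublinear_onD(2)[OF m v])
  with add show ?thesis by (simp add: linear_functional_on_def)
qed

text \<open>The Hahn--Banach theorem in the form of a constraint on a whole cone: first lower \<open>p\<close> along \<open>C\<close>,
then take any minimal, hence linear, functional below the result.\<close>

theorem hahn_banach_cone:
  fixes p :: "'v::real_vector \<Rightarrow> real" and C :: "('v \<times> real) set"
  assumes S: "subspace S" and p: "sublinear_on S p"
    and C: "convex_cone C" and CS: "\<And>w r. (w, r) \<in> C \<Longrightarrow> w \<in> S"
    and nonneg: "\<And>w r. (w, r) \<in> C \<Longrightarrow> 0 \<le> p w + r"
  obtains l where "linear_functional_on S l" "\<And>v. v \<in> S \<Longrightarrow> l v \<le> p v"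
    "\<And>w r. (w, r) \<in> C \<Longrightarrow> 0 \<le> l w + r"
proof -
  obtain g where g: "sublinear_on S g" "\<And>v. v \<notin> S \<Longrightarrow> g v = 0"
    "\<And>v w r. v \<in> S \<Longrightarrow> (w, r) \<in> C \<Longrightarrow> g v \<le> p (v + w) + r"
    by (rule sublinear_lower_by_cone[OF S p C]) (use CS nonneg in blast)+
  obtain l where l: "sublinear_on S l" "\<And>v. v \<notin> S \<Longrightarrow> l v = 0" "\<And>v. l v \<le> g v"
    "\<forall>f. sublinear_on S f \<longrightarrow> (\<forall>v. v \<notin> S \<longrightarrow> f v = 0) \<longrightarrow> (\<forall>v. f v \<le> l v) \<longrightarrow> f = l"
    using minimal_sublinear_exists[OF S g(1,2)] by blast
  have lin: "linear_functional_on S l"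
    using minimal_sublinear_is_linear[OF S l(1,2,4)] .
  show ?thesis
  proof (rule that[OF lin])
    have "(0, 0) \<in> C" using convex_cone_contains_0[OF C] by (simp add: zero_prod_def)
    then show "l v \<le> p v" if "v \<in> S" for v
      using l(3)[of v] g(3)[OF that, of 0 0] by simp
    fix w r assume wr: "(w, r) \<in> C"
    have "l (- w) \<le> g (- w)" by (rule l(3))
    also have "\<dots> \<le> p (- w + w) + r"
      using CS[OF wr] S wr by (intro g(3)) (auto simp: subspace_neg)
    finally have "l (- w) \<le> r" using sublinear_on_zero[OF S p] by simp
    moreover have "l (- w) = - l w"
      using lin CS[OF wr] unfolding linear_functional_on_def
      by (metis scaleR_minus1_left mult_minus1)
    ultimately show "0 \<le> l w + r" by simp
  qed
qed


text \<open>Abstract strong duality. The space \<open>W\<close> consists of the admissible directions paired with the values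
of a linear cost on them, and \<open>m\<close> is a lower bound of the primal problem on the affine space through
\<open>F\<close>. The functional \<open>l\<close> is a dual solution: together with the cost it annihilates \<open>W\<close>, it is dominated by \<open>p\<close>, and
it attains at least \<open>m\<close> at \<open>F\<close>. It comes from the cone generated by \<open>W\<close> and the ray through \<open>(F, - m)\<close>.\<close>

theorem sublinear_duality:
  fixes p :: "'v::real_vector \<Rightarrow> real" and W :: "('v \<times> real) set"
  assumes S: "subspace S" and p: "sublinear_on S p"
    and W: "subspace W" and WS: "\<And>w r. (w, r) \<in> W \<Longrightarrow> w \<in> S" and F: "F \<in> S"
    and lower: "\<And>w r. (w, r) \<in> W \<Longrightarrow> m \<le> p (w + F) + r"
  obtains l where "linear_functional_on S l" "\<And>v. v \<in> S \<Longrightarrow> l v \<le> p v"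
    "\<And>w r. (w, r) \<in> W \<Longrightarrow> l w + r = 0" "m \<le> l F"
proof -
  define C where "C = {(w + t *\<^sub>R F, r - t * m) | w r t. (w, r) \<in> W \<and> 0 \<le> t}"
  have "convex_cone C"
    unfolding convex_cone_iff
  proof (intro conjI ballI allI impI)
    have "(0, 0) \<in> W" using subspace_0[OF W] by (simp add: zero_prod_def)
    then show "0 \<in> C" by (force simp: C_def zero_prod_def)
    fix x y assume "x \<in> C" "y \<in> C"
    then obtain w r t w' r' t' where "(w, r) \<in> W" "0 \<le> t" "x = (w + t *\<^sub>R F, r - t * m)"
      "(w', r') \<in> W" "0 \<le> t'" "y = (w' + t' *\<^sub>R F, r' - t' * m)"
      by (auto simp: C_def)
    then have "(w + w', r + r') \<in> W" "0 \<le> t + t'"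
      "x + y = ((w + w') + (t + t') *\<^sub>R F, (r + r') - (t + t') * m)"
      using subspace_add[OF W, of "(w, r)" "(w', r')"] by (auto simp: algebra_simps)
    then show "x + y \<in> C" unfolding C_def by blast
  next
    fix x and c :: real assume "x \<in> C" "0 \<le> c"
    then obtain w r t where "(w, r) \<in> W" "0 \<le> t" "x = (w + t *\<^sub>R F, r - t * m)"
      by (auto simp: C_def)
    with \<open>0 \<le> c\<close> have "(c *\<^sub>R w, c * r) \<in> W" "0 \<le> c * t"
      "c *\<^sub>R x = (c *\<^sub>R w + (c * t) *\<^sub>R F, c * r - (c * t) * m)"
      using subspace_scale[OF W, of "(w, r)" c] by (auto simp: algebra_simps)
    then show "c *\<^sub>R x \<in> C" unfolding C_def by blast
  qed
  moreover have "x \<in> S" if "(x, r) \<in> C" for x r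
    using that S F WS by (auto simp: C_def subspace_add subspace_scale)
  \<comment> \<open>The lower bound at \<open>F\<close>, rescaled to \<open>t *\<^sub>R F\<close> by homogeneity.\<close>
  moreover have pos: "t * m \<le> p (w + t *\<^sub>R F) + r" if wr: "(w, r) \<in> W" and t: "0 < t" for w r t
  proof -
    have "(inverse t *\<^sub>R w, inverse t * r) \<in> W"
      using subspace_scale[OF W wr, of "inverse t"] by simp
    from mult_left_mono[OF lower[OF this], of t] t
    have "t * m \<le> t * p (inverse t *\<^sub>R w + F) + r" by (simp add: algebra_simps)
    also have "t * p (inverse t *\<^sub>R w + F) = p (t *\<^sub>R (inverse t *\<^sub>R w + F))"
      using t WS[OF wr] F S by (intro sublinear_onD(2)[OF p, symmetric])
        (auto simp: subspace_add subspace_scale)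
    finally show ?thesis using t by (simp add: scaleR_add_right)
  qed
  moreover have "0 \<le> p x + s" if xs: "(x, s) \<in> C" for x s
  proof -
    obtain w r t where wr: "(w, r) \<in> W" and t: "0 \<le> t" and x: "x = w + t *\<^sub>R F" and s: "s = r - t * m"
      using xs by (auto simp: C_def)
    show ?thesis
    proof (cases "t = 0")
      case False
      with pos[OF wr, of t] t x s show ?thesis by simp
    next
      case True
      \<comment> \<open>The face \<open>t = 0\<close> of the cone follows by letting \<open>t\<close> tend to \<open>0\<close>.\<close>
      have small: "\<epsilon> * (m - p F) \<le> p w + r" if \<epsilon>: "0 < \<epsilon>" for \<epsilon>
      proof -
        have "p (w + \<epsilon> *\<^sub>R F) \<le> p w + p (\<epsilon> *\<^sub>R F)"
          using sublinear_onD(1)[OF p WS[OF wr]] F S by (simp add: subspace_scale)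
        then show ?thesis
          using pos[OF wr \<epsilon>] sublinear_onD(2)[OF p F, of \<epsilon>] \<epsilon> by (simp add: right_diff_distrib)
      qed
      have "0 \<le> p w + r"
      proof (rule ccontr)
        assume neg: "\<not> ?thesis"
        then have K: "m - p F < 0" using small[of 1] by simp
        define \<epsilon> where "\<epsilon> = (p w + r) / (2 * (m - p F))"
        have "0 < \<epsilon>" using neg K by (simp add: \<epsilon>_def divide_neg_neg)
        moreover have "\<epsilon> * (m - p F) = (p w + r) / 2" using K by (simp add: \<epsilon>_def divide_simps)
        ultimately show False using small[of \<epsilon>] neg by simp
      qed
      with True x s show ?thesis by simp
    qed
  qed
  ultimately obtain l where lin: "linear_functional_on S l" and le: "\<And>v. v \<in> S \<Longrightarrow> l v \<le> p v"
    and lC: "\<And>w r. (w, r) \<in> C \<Longrightarrow> 0 \<le> l w + r"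
    using hahn_banach_cone[OF S p] by blast
  have WC: "0 \<le> l w + r" if "(w, r) \<in> W" for w r
    using that by (intro lC) (force simp: C_def intro: exI[of _ 0])
  show ?thesis
  proof (rule that[OF lin le])
    fix w r assume wr: "(w, r) \<in> W"
    have "l (- w) = - l w"
      using lin WS[OF wr] unfolding linear_functional_on_def
      by (metis scaleR_minus1_left mult_minus1)
    moreover have "(- w, - r) \<in> W" using subspace_neg[OF W wr] by simp
    ultimately show "l w + r = 0" using WC[OF wr] WC[of "- w" "- r"] by simp
  next
    have "(0, 0) \<in> W" using subspace_0[OF W] by (simp add: zero_prod_def)
    then have "(F, - m) \<in> C" unfolding C_def by (force intro: exI[of _ 1])
    from lC[OF this] show "m \<le> l F" by simp
  qed
qed

section \<open>Functionals bounded by an integral norm\<close>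

text \<open>Function spaces carry the pointwise vector space structure, so that the separation theorem applies
to spaces of vector fields.\<close>

instantiation "fun" :: (type, real_vector) real_vector
begin
definition scaleR_fun :: "real \<Rightarrow> ('a \<Rightarrow> 'b) \<Rightarrow> 'a \<Rightarrow> 'b" where
  "scaleR_fun c f = (\<lambda>x. c *\<^sub>R f x)"
instance
  by standard (auto simp: scaleR_fun_def fun_eq_iff scaleR_add_left scaleR_add_right)
end

lemma plus_fun_eq: "f + g = (\<lambda>x. f x + g x)"
  by (simp add: fun_eq_iff)

lemma subspace_integrable: "subspace {V :: 'a \<Rightarrow> 'b::euclidean_space. integrable M V}"
  by (auto simp: subspace_def plus_fun_eq scaleR_fun_def zero_fun_def)

lemma AE_nonpos_if_set_integrals_nonpos:
  fixes g :: "'a \<Rightarrow> real"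
  assumes g: "integrable M g"
    and le: "\<And>A. A \<in> sets M \<Longrightarrow> (\<integral>x. indicator A x * g x \<partial>M) \<le> 0"
  shows "AE x in M. g x \<le> 0"
proof -
  define A where "A = {x \<in> space M. 0 < g x}"
  have [measurable]: "g \<in> borel_measurable M" using g by simp
  have A: "A \<in> sets M" unfolding A_def by measurable
  have nn: "0 \<le> indicator A x * g x" for x by (auto simp: A_def indicator_def)
  have int: "integrable M (\<lambda>x. indicator A x * g x)"
    using integrable_mult_indicator[OF A g] by simp
  have "(\<integral>x. indicator A x * g x \<partial>M) = 0"
    using le[OF A] Bochner_Integration.integral_nonneg[of M "\<lambda>x. indicator A x * g x"] nn by (simp add: antisym)
  then have "AE x in M. indicator A x * g x = 0"
    using integral_nonneg_eq_0_iff_AE[OF int] nn by simp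
  then show ?thesis
    using AE_space by eventually_elim (auto simp: A_def indicator_def split: if_splits)
qed

text \<open>A linear functional on integrable functions with \<open>l V \<le> \<integral>\<bar>V\<bar>\<close> is the integral against a field of
length at most one. This is the duality of \<open>L\<^sup>1\<close> and \<open>L\<^sup>\<infinity>\<close> on a finite measure space, with the
constant in the Euclidean norm of the values kept sharp. Functions are not identified up to null
sets; the bound makes \<open>l\<close> respect that identification.\<close>

context
  fixes M :: "'a measure" and l :: "('a \<Rightarrow> 'b::euclidean_space) \<Rightarrow> real"
  assumes fin: "finite_measure M"
    and lin: "linear_functional_on {V. integrable M V} l"
    and bound: "\<And>V. integrable M V \<Longrightarrow> l V \<le> (\<integral>x. norm (V x) \<partial>M)"
begin

interpretation finite_measure M by (rule fin)

lemma L1_functional_add: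
  "integrable M V \<Longrightarrow> integrable M W \<Longrightarrow> l (\<lambda>x. V x + W x) = l V + l W"
  using lin by (simp add: linear_functional_on_def plus_fun_eq)

lemma L1_functional_scale: "integrable M V \<Longrightarrow> l (\<lambda>x. c *\<^sub>R V x) = c * l V"
  using lin by (simp add: linear_functional_on_def scaleR_fun_def)

lemma L1_functional_abs_le:
  assumes "integrable M V"
  shows "\<bar>l V\<bar> \<le> (\<integral>x. norm (V x) \<partial>M)"
  using bound[OF assms] bound[of "\<lambda>x. (-1) *\<^sub>R V x"] L1_functional_scale[OF assms, of "-1"] assms
  by simp

lemma L1_functional_indicator_abs_le:
  assumes A: "A \<in> sets M" and b: "norm b = 1"
  shows "\<bar>l (\<lambda>x. indicator A x *\<^sub>R b)\<bar> \<le> measure M A"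
proof -
  have "\<bar>l (\<lambda>x. indicator A x *\<^sub>R b)\<bar> \<le> (\<integral>x. norm (indicator A x *\<^sub>R b) \<partial>M)"
    using A by (intro L1_functional_abs_le) (auto simp: emeasure_finite less_top[symmetric])
  also have "\<dots> = (\<integral>x. indicator A x \<partial>M)"
    using b by (intro Bochner_Integration.integral_cong) (auto simp: indicator_def)
  also have "\<dots> = measure M A" using A by (simp add: sets.Int_space_eq2)
  finally show ?thesis .
qed

text \<open>The set function \<open>A \<mapsto> l (indicator A *\<^sub>R b)\<close> is a signed measure dominated by \<open>M\<close>. Adding \<open>M\<close> makes it
nonnegative and bounded by \<open>2 M\<close>, so that the Radon--Nikodym theorem for positive measures applies;
the density then lies between \<open>0\<close> and \<open>2\<close>, and subtracting \<open>1\<close> restores the signed one.\<close>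

lemma L1_functional_directional_density:
  assumes b: "norm b = 1"
  shows "\<exists>k. k \<in> borel_measurable M \<and> integrable M k \<and> (AE x in M. \<bar>k x\<bar> \<le> 1) \<and>
    (\<forall>A\<in>sets M. l (\<lambda>x. indicator A x *\<^sub>R b) = (\<integral>x. indicator A x * k x \<partial>M))"
proof -
  define \<tau> where "\<tau> A = l (\<lambda>x. indicator A x *\<^sub>R b) + measure M A" for A
  have int: "integrable M (\<lambda>x. indicator A x *\<^sub>R b)" if "A \<in> sets M" for A
    using that by (auto simp: emeasure_finite less_top[symmetric])
  have \<tau>: "0 \<le> \<tau> A" "\<tau> A \<le> 2 * measure M A" if "A \<in> sets M" for A
    using L1_functional_indicator_abs_le[OF that b] by (auto simp: \<tau>_def)
  have \<tau>_empty: "\<tau> {} = 0" using \<tau>[of "{}"] by simp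
  have \<tau>_Un: "\<tau> (A \<union> B) = \<tau> A + \<tau> B" if "A \<in> sets M" "B \<in> sets M" "A \<inter> B = {}" for A B
  proof -
    have "(\<lambda>x. indicator (A \<union> B) x *\<^sub>R b) = (\<lambda>x. indicator A x *\<^sub>R b + indicator B x *\<^sub>R b)"
      using that(3) by (auto simp: fun_eq_iff indicator_def)
    then show ?thesis
      using L1_functional_add[OF int int, OF that(1,2)] that finite_measure_Union
      by (simp add: \<tau>_def)
  qed
  define N where "N = measure_of (space M) (sets M) (\<lambda>A. ennreal (\<tau> A))"
  have sets_N[measurable_cong]: "sets N = sets M" and space_N: "space N = space M"
    by (simp_all add: N_def)
  have pos: "positive (sets M) (\<lambda>A. ennreal (\<tau> A))"
    by (simp add: positive_def \<tau>_empty)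
  have "countably_additive (sets M) (\<lambda>A. ennreal (\<tau> A))"
  proof (rule sets.empty_continuous_imp_countably_additive[OF pos])
    show "additive (sets M) (\<lambda>A. ennreal (\<tau> A))"
      using \<tau> by (auto simp: additive_def \<tau>_Un ennreal_plus)
    show "\<forall>A\<in>sets M. ennreal (\<tau> A) \<noteq> \<infinity>" by simp
    fix A :: "nat \<Rightarrow> 'a set"
    assume A: "range A \<subseteq> sets M" "decseq A" "(\<Inter>i. A i) = {}"
    have "(\<lambda>i. measure M (A i)) \<longlonglongrightarrow> 0"
      using finite_Lim_measure_decseq[OF A(1,2)] A(3) by simp
    then have "(\<lambda>i. 2 * measure M (A i)) \<longlonglongrightarrow> 0"
      by (auto intro: tendsto_mult_right_zero)
    then have "(\<lambda>i. \<tau> (A i)) \<longlonglongrightarrow> 0"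
    proof (rule tendsto_sandwich[OF _ _ tendsto_const, rotated 2])
      show "\<forall>\<^sub>F i in sequentially. 0 \<le> \<tau> (A i)"
        using A(1) by (intro always_eventually allI \<tau>) auto
      show "\<forall>\<^sub>F i in sequentially. \<tau> (A i) \<le> 2 * measure M (A i)"
        using A(1) by (intro always_eventually allI \<tau>) auto
    qed
    then show "(\<lambda>i. ennreal (\<tau> (A i))) \<longlonglongrightarrow> 0"
      by (metis ennreal_0 tendsto_ennrealI)
  qed
  then have N: "emeasure N A = ennreal (\<tau> A)" if "A \<in> sets M" for A
    using that pos unfolding N_def by (intro emeasure_measure_of_sigma) (auto simp: sets.sigma_algebra_axioms)
  have fin_N: "finite_measure N"
    by (rule finite_measureI) (simp add: space_N N)
  have ac: "absolutely_continuous M N"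
    unfolding absolutely_continuous_def
  proof
    fix A assume "A \<in> null_sets M"
    then show "A \<in> null_sets N"
      using \<tau>[of A] by (auto simp: null_sets_def sets_N N measure_def)
  qed
  obtain D where D[measurable]: "D \<in> borel_measurable M"
    and RN: "AE x in M. RN_deriv M N x = ennreal (D x)" and "AE x in N. 0 < D x"
    and D0: "\<And>x. 0 \<le> D x"
    by (rule real_RN_deriv[OF fin_N ac sets_N], rule that)
  have ND: "ennreal (\<tau> A) = (\<integral>\<^sup>+x. ennreal (indicator A x * D x) \<partial>M)" if A: "A \<in> sets M" for A
  proof -
    have "ennreal (\<tau> A) = emeasure (density M (RN_deriv M N)) A"
      using density_RN_deriv[OF ac sets_N] N[OF A] by simp
    also have "\<dots> = (\<integral>\<^sup>+x. RN_deriv M N x * indicator A x \<partial>M)"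
      using A by (simp add: emeasure_density)
    also have "\<dots> = (\<integral>\<^sup>+x. ennreal (indicator A x * D x) \<partial>M)"
      using RN by (intro nn_integral_cong_AE, eventually_elim) (auto simp: indicator_def)
    finally show ?thesis .
  qed
  have intD: "integrable M D"
  proof (rule integrableI_nonneg)
    have "(\<integral>\<^sup>+x. ennreal (D x) \<partial>M) = ennreal (\<tau> (space M))"
      unfolding ND[OF sets.top] by (intro nn_integral_cong) simp
    then show "(\<integral>\<^sup>+x. ennreal (D x) \<partial>M) < \<infinity>" by simp
  qed (auto simp: D0)
  have \<tau>D: "\<tau> A = (\<integral>x. indicator A x * D x \<partial>M)" if A: "A \<in> sets M" for A
  proof -
    have "(\<integral>x. indicator A x * D x \<partial>M) = enn2real (\<integral>\<^sup>+x. ennreal (indicator A x * D x) \<partial>M)"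
      using A D0 by (intro integral_eq_nn_integral) auto
    then show ?thesis using ND[OF A, symmetric] \<tau>[OF A] by simp
  qed
  have int_ind: "integrable M (\<lambda>x. indicator A x * D x)" if "A \<in> sets M" for A
    using integrable_mult_indicator[OF that intD] by simp
  have int_mA: "integrable M (\<lambda>x. indicator A x :: real)" if "A \<in> sets M" for A
    using that by (auto simp: emeasure_finite less_top[symmetric])
  have mA: "(\<integral>x. indicator A x \<partial>M) = measure M A" if "A \<in> sets M" for A
    using that by (simp add: sets.Int_space_eq2)
  define k where "k x = D x - 1" for x
  show ?thesis
  proof (intro exI[of _ k] conjI ballI)
    show "k \<in> borel_measurable M" "integrable M k" using intD by (auto simp: k_def[abs_def])
    have "AE x in M. D x - 2 \<le> 0"
    proof (rule AE_nonpos_if_set_integrals_nonpos)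
      fix A assume A: "A \<in> sets M"
      have "(\<integral>x. indicator A x * (D x - 2) \<partial>M) = (\<integral>x. indicator A x * D x - 2 * indicator A x \<partial>M)"
        by (simp add: algebra_simps)
      also have "\<dots> = \<tau> A - 2 * measure M A"
        using int_ind[OF A] int_mA[OF A] mA[OF A] by (simp add: \<tau>D[OF A])
      also have "\<dots> \<le> 0" using \<tau>[OF A] by simp
      finally show "(\<integral>x. indicator A x * (D x - 2) \<partial>M) \<le> 0" .
    qed (use intD in auto)
    then show "AE x in M. \<bar>k x\<bar> \<le> 1"
    proof eventually_elim
      case (elim x)
      then show ?case using D0[of x] by (simp add: k_def abs_le_iff)
    qed
    fix A assume A: "A \<in> sets M"
    have "(\<integral>x. indicator A x * k x \<partial>M) = (\<integral>x. indicator A x * D x - indicator A x \<partial>M)"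
      by (simp add: k_def algebra_simps)
    also have "\<dots> = \<tau> A - measure M A"
      using int_ind[OF A] int_mA[OF A] mA[OF A] by (simp add: \<tau>D[OF A])
    finally show "l (\<lambda>x. indicator A x *\<^sub>R b) = (\<integral>x. indicator A x * k x \<partial>M)"
      by (simp add: \<tau>_def)
  qed
qed

text \<open>The densities in the coordinate directions form a field \<open>h\<close> with the crude bound \<open>\<bar>h\<bar> \<le> DIM('b)\<close>, enough to
pass from simple to integrable functions by dominated convergence. Testing the representation with
\<open>V = sgn h\<close> on a measurable set improves the bound to the sharp one.\<close>

theorem L1_functional_representation:
  obtains h :: "'a \<Rightarrow> 'b" where "h \<in> borel_measurable M" "AE x in M. norm (h x) \<le> 1"
    "\<And>V. integrable M V \<Longrightarrow> l V = (\<integral>x. V x \<bullet> h x \<partial>M)"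
proof -
  have "\<forall>b\<in>Basis. \<exists>k. k \<in> borel_measurable M \<and> integrable M k \<and> (AE x in M. \<bar>k x\<bar> \<le> 1) \<and>
      (\<forall>A\<in>sets M. l (\<lambda>x. indicator A x *\<^sub>R b) = (\<integral>x. indicator A x * k x \<partial>M))"
    by (intro ballI L1_functional_directional_density norm_Basis)
  from bchoice[OF this] obtain k :: "'b \<Rightarrow> 'a \<Rightarrow> real" where k_all:
    "\<forall>b\<in>Basis. k b \<in> borel_measurable M \<and> integrable M (k b) \<and> (AE x in M. \<bar>k b x\<bar> \<le> 1) \<and>
      (\<forall>A\<in>sets M. l (\<lambda>x. indicator A x *\<^sub>R b) = (\<integral>x. indicator A x * k b x \<partial>M))"
    by blast
  have k_meas[measurable]: "k b \<in> borel_measurable M"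
    and k_int: "integrable M (k b)"
    and k_bound: "AE x in M. \<bar>k b x\<bar> \<le> 1" if "b \<in> Basis" for b
    using k_all that by blast+
  have k: "l (\<lambda>x. indicator A x *\<^sub>R b) = (\<integral>x. indicator A x * k b x \<partial>M)"
    if "b \<in> Basis" "A \<in> sets M" for b A
    using k_all that by blast
  define h where "h x = (\<Sum>b\<in>Basis. k b x *\<^sub>R b)" for x
  have h_meas[measurable]: "h \<in> borel_measurable M"
    unfolding h_def by (intro borel_measurable_sum borel_measurable_scaleR) auto
  have inner_h: "v \<bullet> h x = (\<Sum>b\<in>Basis. (v \<bullet> b) * k b x)" for v x
    by (simp add: h_def inner_sum_right mult.commute)
  have h_int: "integrable M h"
    unfolding h_def by (intro Bochner_Integration.integrable_sum integrable_scaleR_left k_int)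
  have h_bound: "AE x in M. norm (h x) \<le> DIM('b)"
  proof -
    have "AE x in M. \<forall>b\<in>Basis. \<bar>k b x\<bar> \<le> 1" using k_bound by (simp add: AE_finite_all)
    then show ?thesis
    proof eventually_elim
      case (elim x)
      have "norm (h x) \<le> (\<Sum>b\<in>Basis. norm (k b x *\<^sub>R b))" unfolding h_def by (rule norm_sum)
      also have "\<dots> \<le> (\<Sum>b\<in>(Basis :: 'b set). 1)" using elim by (intro sum_mono) auto
      finally show ?case by simp
    qed
  qed
  have int_inner: "integrable M (\<lambda>x. V x \<bullet> h x)" if V: "integrable M V" for V
  proof (rule Bochner_Integration.integrable_bound)
    show "integrable M (\<lambda>x. DIM('b) *\<^sub>R V x)" using V by simp
    show "AE x in M. norm (V x \<bullet> h x) \<le> norm (DIM('b) *\<^sub>R V x)"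
      using h_bound
    proof eventually_elim
      case (elim x)
      have "norm (V x \<bullet> h x) \<le> norm (V x) * norm (h x)" by (simp add: Cauchy_Schwarz_ineq2)
      also have "\<dots> \<le> norm (V x) * DIM('b)" using elim by (intro mult_left_mono) auto
      finally show ?case by (simp add: mult.commute)
    qed
  qed (use V in measurable)
  have rep: "l V = (\<integral>x. V x \<bullet> h x \<partial>M)" if "integrable M V" for V
    using that
  proof (induction rule: integrable_induct)
    case (base A c)
    have ints: "integrable M (\<lambda>x. indicator A x *\<^sub>R b)" for b :: 'b using base by auto
    have "l (\<lambda>x. indicator A x *\<^sub>R c) = l (\<lambda>x. \<Sum>b\<in>Basis. (c \<bullet> b) *\<^sub>R (indicator A x *\<^sub>R b))"
      by (subst euclidean_representation[of c, symmetric])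
        (simp only: scaleR_sum_right scaleR_left_commute)
    also have "\<dots> = (\<Sum>b\<in>Basis. (c \<bullet> b) * l (\<lambda>x. indicator A x *\<^sub>R b))"
    proof -
      have "l (\<lambda>x. \<Sum>b\<in>B. (c \<bullet> b) *\<^sub>R (indicator A x *\<^sub>R b))
          = (\<Sum>b\<in>B. (c \<bullet> b) * l (\<lambda>x. indicator A x *\<^sub>R b))" if "finite B" for B
        using that
      proof induction
        case empty
        then show ?case using L1_functional_scale[of "\<lambda>x. 0" 0] by simp
      next
        case (insert b B)
        have "l (\<lambda>x. \<Sum>b\<in>insert b B. (c \<bullet> b) *\<^sub>R (indicator A x *\<^sub>R b))
            = l (\<lambda>x. (c \<bullet> b) *\<^sub>R (indicator A x *\<^sub>R b) + (\<Sum>b\<in>B. (c \<bullet> b) *\<^sub>R (indicator A x *\<^sub>R b)))"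
          using insert.hyps by simp
        also have "\<dots> = (c \<bullet> b) * l (\<lambda>x. indicator A x *\<^sub>R b)
            + l (\<lambda>x. \<Sum>b\<in>B. (c \<bullet> b) *\<^sub>R (indicator A x *\<^sub>R b))"
        proof -
          have "integrable M (\<lambda>x. (c \<bullet> b) *\<^sub>R (indicator A x *\<^sub>R b))" for b :: 'b
            by (rule integrable_scaleR_right[OF ints])
          then show ?thesis
            by (simp only: L1_functional_add Bochner_Integration.integrable_sum L1_functional_scale[OF ints])
        qed
        finally show ?case using insert by simp
      qed
      then show ?thesis by simp
    qed
    also have "\<dots> = (\<Sum>b\<in>Basis. \<integral>x. (c \<bullet> b) * (indicator A x * k b x) \<partial>M)"
      using k base by simp
    also have "\<dots> = (\<integral>x. (\<Sum>b\<in>Basis. (c \<bullet> b) * (indicator A x * k b x)) \<partial>M)"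
      using integrable_mult_indicator[OF base(1) k_int]
      by (intro Bochner_Integration.integral_sum[symmetric] integrable_mult_right) auto
    also have "\<dots> = (\<integral>x. (indicator A x *\<^sub>R c) \<bullet> h x \<partial>M)"
      by (simp add: inner_h sum_distrib_left mult_ac)
    finally show ?case .
  next
    case (add V W)
    then show ?case
      using int_inner[OF add(1)] int_inner[OF add(2)]
      by (simp add: L1_functional_add inner_add_left)
  next
    case (lim V s)
    have nV: "integrable M (\<lambda>x. 2 * norm (V x))" using lim.hyps by simp
    have "(\<lambda>i. \<integral>x. s i x \<bullet> h x \<partial>M) \<longlonglongrightarrow> (\<integral>x. V x \<bullet> h x \<partial>M)"
    proof (rule integral_dominated_convergence)
      show "integrable M (\<lambda>x. 2 * norm (V x) * DIM('b))" using nV by simp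
      show "AE x in M. (\<lambda>i. s i x \<bullet> h x) \<longlonglongrightarrow> V x \<bullet> h x"
        using lim.hyps(2) by (auto intro!: AE_I2 tendsto_inner)
      show "AE x in M. norm (s i x \<bullet> h x) \<le> 2 * norm (V x) * DIM('b)" for i
        using h_bound AE_space
      proof eventually_elim
        case (elim x)
        have "norm (s i x \<bullet> h x) \<le> norm (s i x) * norm (h x)" by (simp add: Cauchy_Schwarz_ineq2)
        also have "\<dots> \<le> (2 * norm (V x)) * DIM('b)" using elim lim.hyps(3) by (intro mult_mono) auto
        finally show ?case by simp
      qed
    qed (use lim.hyps(1,4) in measurable)
    moreover have "(\<lambda>i. l (s i)) \<longlonglongrightarrow> l V"
    proof -
      have "(\<lambda>i. \<integral>x. norm (V x - s i x) \<partial>M) \<longlonglongrightarrow> (\<integral>x. 0 \<partial>M)"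
      proof (rule integral_dominated_convergence)
        show "integrable M (\<lambda>x. 3 * norm (V x))" using lim.hyps by simp
        show "AE x in M. (\<lambda>i. norm (V x - s i x)) \<longlonglongrightarrow> 0"
        proof (rule AE_I2)
          fix x assume "x \<in> space M"
          from tendsto_norm[OF tendsto_diff[OF tendsto_const lim.hyps(2)[OF this]], of "V x"]
          show "(\<lambda>i. norm (V x - s i x)) \<longlonglongrightarrow> 0" by simp
        qed
        show "AE x in M. norm (norm (V x - s i x)) \<le> 3 * norm (V x)" for i
        proof (rule AE_I2)
          fix x assume "x \<in> space M"
          then show "norm (norm (V x - s i x)) \<le> 3 * norm (V x)"
            using norm_triangle_ineq4[of "V x" "s i x"] lim.hyps(3)[of x i] by simp
        qed
      qed (use lim.hyps(1,4) in measurable)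
      then have z: "(\<lambda>i. \<integral>x. norm (V x - s i x) \<partial>M) \<longlonglongrightarrow> 0" by simp
      have "norm (l (s i) - l V) \<le> (\<integral>x. norm (V x - s i x) \<partial>M)" for i
      proof -
        have "l (\<lambda>x. V x - s i x) = l V - l (s i)"
          using L1_functional_add[of V "\<lambda>x. (-1) *\<^sub>R s i x"] L1_functional_scale[of "s i" "-1"]
            lim.hyps(1,4) by simp
        then show ?thesis
          using L1_functional_abs_le[of "\<lambda>x. V x - s i x"] lim.hyps(1,4) by (simp add: abs_minus_commute)
      qed
      then have "(\<lambda>i. l (s i) - l V) \<longlonglongrightarrow> 0"
        by (intro Lim_null_comparison[OF always_eventually z]) simp
      then show ?thesis by (rule LIM_zero_cancel)
    qed
    ultimately show ?case using lim.IH by (simp add: LIMSEQ_unique)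
  qed
  have "AE x in M. norm (h x) - 1 \<le> 0"
  proof (rule AE_nonpos_if_set_integrals_nonpos)
    show "integrable M (\<lambda>x. norm (h x) - 1)" using h_int by simp
    fix A assume A: "A \<in> sets M"
    define V where "V x = indicator A x *\<^sub>R sgn (h x)" for x
    have [measurable]: "V \<in> borel_measurable M" using A unfolding V_def sgn_div_norm by measurable
    have V1: "norm (V x) \<le> indicator A x" for x by (auto simp: V_def norm_sgn indicator_def)
    have indA: "integrable M (\<lambda>x. indicator A x :: real)"
      using A by (auto simp: emeasure_finite less_top[symmetric])
    have V: "integrable M V"
      by (rule Bochner_Integration.integrable_bound[OF indA]) (use V1 in auto)
    have Vh: "V x \<bullet> h x = indicator A x * norm (h x)" for x
      by (cases "h x = 0")
        (simp_all add: V_def sgn_div_norm power2_norm_eq_inner[symmetric] power2_eq_square)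
    have "(\<integral>x. indicator A x * norm (h x) \<partial>M) = l V" using rep[OF V] by (simp add: Vh)
    also have "\<dots> \<le> (\<integral>x. norm (V x) \<partial>M)" by (rule bound[OF V])
    also have "\<dots> \<le> (\<integral>x. indicator A x \<partial>M)"
      using V V1 indA by (intro integral_mono) auto
    finally have "(\<integral>x. indicator A x * norm (h x) \<partial>M) - (\<integral>x. indicator A x \<partial>M) \<le> 0" by simp
    moreover have "integrable M (\<lambda>x. indicator A x * norm (h x))"
      using int_inner[OF V] by (simp add: Vh)
    ultimately show "(\<integral>x. indicator A x * (norm (h x) - 1) \<partial>M) \<le> 0"
      using indA by (simp add: right_diff_distrib)
  qed
  then have "AE x in M. norm (h x) \<le> 1" by simp
  with rep show ?thesis using that h_meas by blast
qed

end

section \<open>Square-integrable fields on bounded domains\<close>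

lemma L2_measurable: "f \<in> L2 \<Omega> \<Longrightarrow> f \<in> borel_measurable (lebesgue_on \<Omega>)"
  by (simp add: L2_def)

lemma L2_square_integrable: "f \<in> L2 \<Omega> \<Longrightarrow> integrable (lebesgue_on \<Omega>) (\<lambda>x. (norm (f x))\<^sup>2)"
  by (simp add: L2_def)

lemma L2_norm_mult_integrable:
  assumes f: "f \<in> L2 \<Omega>" and g: "g \<in> L2 \<Omega>"
  shows "integrable (lebesgue_on \<Omega>) (\<lambda>x. norm (f x) * norm (g x))"
proof (rule Bochner_Integration.integrable_bound)
  show "integrable (lebesgue_on \<Omega>) (\<lambda>x. (norm (f x))\<^sup>2 + (norm (g x))\<^sup>2)"
    using f g by (simp add: L2_square_integrable)
  have "norm (f x) * norm (g x) \<le> (norm (f x))\<^sup>2 + (norm (g x))\<^sup>2" for x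
    using sum_squares_bound[of "norm (f x)" "norm (g x)"]
      mult_nonneg_nonneg[OF norm_ge_zero norm_ge_zero, of "f x" "g x"] by linarith
  then show "AE x in lebesgue_on \<Omega>. norm (norm (f x) * norm (g x))
      \<le> norm ((norm (f x))\<^sup>2 + (norm (g x))\<^sup>2)"
    by simp
  show "(\<lambda>x. norm (f x) * norm (g x)) \<in> borel_measurable (lebesgue_on \<Omega>)"
    using L2_measurable[OF f] L2_measurable[OF g] by measurable
qed

lemma L2_mult_integrable:
  fixes f g :: "real^'n \<Rightarrow> real"
  assumes f: "f \<in> L2 \<Omega>" and g: "g \<in> L2 \<Omega>"
  shows "integrable (lebesgue_on \<Omega>) (\<lambda>x. f x * g x)"
  using L2_measurable[OF f] L2_measurable[OF g]
  by (intro Bochner_Integration.integrable_bound[OF L2_norm_mult_integrable[OF f g]])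
    (auto simp: abs_mult)

lemma L2_scaleR_integrable:
  fixes f :: "real^'n \<Rightarrow> real"
  assumes f: "f \<in> L2 \<Omega>" and g: "g \<in> L2 \<Omega>"
  shows "integrable (lebesgue_on \<Omega>) (\<lambda>x. f x *\<^sub>R g x)"
  using L2_measurable[OF f] L2_measurable[OF g]
  by (intro Bochner_Integration.integrable_bound[OF L2_norm_mult_integrable[OF f g]]) auto

lemma L2_inner_integrable:
  assumes f: "f \<in> L2 \<Omega>" and g: "g \<in> L2 \<Omega>"
  shows "integrable (lebesgue_on \<Omega>) (\<lambda>x. f x \<bullet> g x)"
  using L2_measurable[OF f] L2_measurable[OF g]
  by (intro Bochner_Integration.integrable_bound[OF L2_norm_mult_integrable[OF f g]])
    (auto simp: Cauchy_Schwarz_ineq2)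

lemma L2_add:
  assumes f: "f \<in> L2 \<Omega>" and g: "g \<in> L2 \<Omega>"
  shows "(\<lambda>x. f x + g x) \<in> L2 \<Omega>"
proof -
  have [measurable]: "f \<in> borel_measurable (lebesgue_on \<Omega>)" "g \<in> borel_measurable (lebesgue_on \<Omega>)"
    using f g by (simp_all add: L2_measurable)
  have "integrable (lebesgue_on \<Omega>) (\<lambda>x. (norm (f x + g x))\<^sup>2)"
  proof (rule Bochner_Integration.integrable_bound)
    show "integrable (lebesgue_on \<Omega>)
        (\<lambda>x. (norm (f x))\<^sup>2 + 2 * (norm (f x) * norm (g x)) + (norm (g x))\<^sup>2)"
      using f g by (simp add: L2_square_integrable L2_norm_mult_integrable)
    have "(norm (f x + g x))\<^sup>2 \<le> (norm (f x))\<^sup>2 + 2 * (norm (f x) * norm (g x)) + (norm (g x))\<^sup>2" for x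
      using power_mono[OF norm_triangle_ineq[of "f x" "g x"], of 2] by (simp add: power2_sum)
    then show "AE x in lebesgue_on \<Omega>. norm ((norm (f x + g x))\<^sup>2)
        \<le> norm ((norm (f x))\<^sup>2 + 2 * (norm (f x) * norm (g x)) + (norm (g x))\<^sup>2)"
      by simp
  qed measurable
  then show ?thesis by (simp add: L2_def)
qed

lemma L2_scaleR: "f \<in> L2 \<Omega> \<Longrightarrow> (\<lambda>x. c *\<^sub>R f x) \<in> L2 \<Omega>"
  by (auto simp: L2_def power_mult_distrib)

lemma L2_norm: "f \<in> L2 \<Omega> \<Longrightarrow> (\<lambda>x. norm (f x)) \<in> L2 \<Omega>"
  by (auto simp: L2_def)

lemma L2_dominated:
  assumes f: "f \<in> borel_measurable (lebesgue_on \<Omega>)" and g: "g \<in> L2 \<Omega>"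
    and le: "AE x in lebesgue_on \<Omega>. norm (f x) \<le> norm (g x)"
  shows "f \<in> L2 \<Omega>"
proof -
  have "integrable (lebesgue_on \<Omega>) (\<lambda>x. (norm (f x))\<^sup>2)"
  proof (rule Bochner_Integration.integrable_bound[OF L2_square_integrable[OF g]])
    show "AE x in lebesgue_on \<Omega>. norm ((norm (f x))\<^sup>2) \<le> norm ((norm (g x))\<^sup>2)"
      using le by eventually_elim (simp add: power_mono)
  qed (use f in measurable)
  with f show ?thesis by (simp add: L2_def)
qed

lemma L2_const:
  assumes "open \<Omega>" "bounded \<Omega>"
  shows "(\<lambda>x. c) \<in> L2 \<Omega>"
proof -
  interpret finite_measure "lebesgue_on \<Omega>"
    using assms by (intro finite_measure_lebesgue_on lmeasurable_open)
  show ?thesis by (simp add: L2_def)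
qed

lemma L2_integrable:
  fixes f :: "real^'n \<Rightarrow> 'b::euclidean_space"
  assumes "open \<Omega>" "bounded \<Omega>" "f \<in> L2 \<Omega>"
  shows "integrable (lebesgue_on \<Omega>) f"
  using L2_scaleR_integrable[OF L2_const[OF assms(1,2), of 1] assms(3)] by simp

text \<open>Continuity on the whole space bounds \<open>f\<close> on the compact closure of \<open>\<Omega>\<close>.\<close>

lemma L2_continuous:
  fixes f :: "real^'n \<Rightarrow> 'b::euclidean_space"
  assumes \<Omega>: "open \<Omega>" "bounded \<Omega>" and f: "continuous_on UNIV f"
  shows "f \<in> L2 \<Omega>"
proof -
  have "compact (f ` closure \<Omega>)"
    using \<Omega>(2) f by (intro compact_continuous_image)
      (auto intro: continuous_on_subset simp: compact_closure)
  then have "bounded (f ` closure \<Omega>)" by (rule compact_imp_bounded)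
  then obtain B where B: "\<And>x. x \<in> closure \<Omega> \<Longrightarrow> norm (f x) \<le> B"
    by (auto simp: bounded_iff)
  show ?thesis
  proof (rule L2_dominated[OF _ L2_const[OF \<Omega>, of B]])
    show "f \<in> borel_measurable (lebesgue_on \<Omega>)"
      using \<Omega>(1) f by (intro continuous_imp_measurable_on_sets_lebesgue)
        (auto intro: continuous_on_subset)
    show "AE x in lebesgue_on \<Omega>. norm (f x) \<le> norm B"
      using B closure_subset[of \<Omega>] by (intro AE_I2) (force simp: space_restrict_space)
  qed
qed

section \<open>The space of mean-zero Sobolev functions\<close>

text \<open>The weak-gradient identity is linear in the function and its gradient only once the integrals in it
converge, because a divergent integral has the value \<open>0\<close>. Square integrability of test functions
and their gradients settles this.\<close>

lemma test_function_L2: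
  assumes \<Omega>: "open \<Omega>" "bounded \<Omega>" and \<phi>: "test_function \<Omega> \<phi>"
    and g: "\<forall>x. GDERIV \<phi> x :> g x"
  shows "\<phi> \<in> L2 \<Omega>" "g \<in> L2 \<Omega>"
proof -
  have C: "C_k 0 \<phi>" "C_k (Suc 0) \<phi>" using \<phi> unfolding test_function_def by blast+
  then show "\<phi> \<in> L2 \<Omega>" by (intro L2_continuous \<Omega>) simp
  obtain g' where g': "\<And>x. GDERIV \<phi> x :> g' x" "\<And>i. continuous_on UNIV (\<lambda>x. g' x $ i)"
    using C(2) by auto
  have "g x = g' x" for x
  proof -
    have "(\<lambda>h. h \<bullet> g x) = (\<lambda>h. h \<bullet> g' x)"
      using g g'(1) by (intro has_derivative_unique[of \<phi> _ x]) (auto simp: gderiv_def)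
    then show ?thesis by (simp add: fun_eq_iff vector_eq_ldot)
  qed
  then have "continuous_on UNIV (\<lambda>x. \<chi> i. g x $ i)"
    using g'(2) by (intro continuous_on_vec_lambda) simp
  then show "g \<in> L2 \<Omega>" by (intro L2_continuous \<Omega>) simp
qed

lemma has_H1_gradient_add:
  assumes \<Omega>: "open \<Omega>" "bounded \<Omega>"
    and u: "has_H1_gradient \<Omega> u G" and v: "has_H1_gradient \<Omega> v K"
  shows "has_H1_gradient \<Omega> (\<lambda>x. u x + v x) (\<lambda>x. G x + K x)"
  unfolding has_H1_gradient_def
proof (intro conjI allI impI)
  fix \<phi> g assume \<phi>: "test_function \<Omega> \<phi>" and g: "\<forall>x. GDERIV \<phi> x :> g x"
  note [simp] = L2_scaleR_integrable test_function_L2[OF \<Omega> \<phi> g]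
  show "(\<integral>x. (u x + v x) *\<^sub>R g x \<partial>(lebesgue_on \<Omega>)) = - (\<integral>x. \<phi> x *\<^sub>R (G x + K x) \<partial>(lebesgue_on \<Omega>))"
    using u v \<phi> g by (simp add: has_H1_gradient_def scaleR_add_left scaleR_add_right)
qed (use u v in \<open>auto simp: has_H1_gradient_def intro: L2_add\<close>)

lemma has_H1_gradient_scaleR:
  assumes u: "has_H1_gradient \<Omega> u G"
  shows "has_H1_gradient \<Omega> (\<lambda>x. c * u x) (\<lambda>x. c *\<^sub>R G x)"
  unfolding has_H1_gradient_def
proof (intro conjI allI impI)
  fix \<phi> g assume \<phi>: "test_function \<Omega> \<phi>" and g: "\<forall>x. GDERIV \<phi> x :> g x"
  have "(\<integral>x. (c * u x) *\<^sub>R g x \<partial>(lebesgue_on \<Omega>)) = c *\<^sub>R (\<integral>x. u x *\<^sub>R g x \<partial>(lebesgue_on \<Omega>))"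
    by (simp flip: scaleR_scaleR)
  also have "\<dots> = - (c *\<^sub>R (\<integral>x. \<phi> x *\<^sub>R G x \<partial>(lebesgue_on \<Omega>)))"
    using u \<phi> g by (simp add: has_H1_gradient_def)
  also have "\<dots> = - (\<integral>x. \<phi> x *\<^sub>R (c *\<^sub>R G x) \<partial>(lebesgue_on \<Omega>))"
    by (simp add: mult.commute flip: integral_scaleR_right)
  finally show "(\<integral>x. (c * u x) *\<^sub>R g x \<partial>(lebesgue_on \<Omega>)) = - (\<integral>x. \<phi> x *\<^sub>R (c *\<^sub>R G x) \<partial>(lebesgue_on \<Omega>))" .
qed (use u L2_scaleR[of u \<Omega> c] L2_scaleR[of G \<Omega> c] in \<open>auto simp: has_H1_gradient_def\<close>)

lemma has_H1_gradient_zero: "has_H1_gradient \<Omega> (\<lambda>x. 0) (\<lambda>x. 0)"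
  by (simp add: has_H1_gradient_def L2_def)

text \<open>The competitors of the primal problem. The gradient is carried along, since it is
  determined by the function only up to null sets.\<close>

definition mean_zero_pair :: "(real^'n) set \<Rightarrow> (real^'n \<Rightarrow> real) \<Rightarrow> (real^'n \<Rightarrow> real^'n) \<Rightarrow> bool" where
  "mean_zero_pair \<Omega> u G \<longleftrightarrow> u \<in> H1_mean_zero \<Omega> \<and> has_H1_gradient \<Omega> u G"

lemma mean_zero_pair_iff:
  "mean_zero_pair \<Omega> u G \<longleftrightarrow> has_H1_gradient \<Omega> u G \<and> (\<integral>x. u x \<partial>(lebesgue_on \<Omega>)) = 0"
  by (auto simp: mean_zero_pair_def H1_mean_zero_def H1_def)

lemma mean_zero_pair_L2:
  assumes "mean_zero_pair \<Omega> u G"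
  shows "u \<in> L2 \<Omega>" "G \<in> L2 \<Omega>"
  using assms by (auto simp: mean_zero_pair_iff has_H1_gradient_def)

text \<open>The space \<open>W\<close> to which abstract duality is applied.\<close>

lemma subspace_mean_zero_pairs:
  assumes \<Omega>: "open \<Omega>" "bounded \<Omega>" and H: "H \<in> L2 \<Omega>"
  shows "subspace {(G, \<integral>x. H x * u x \<partial>(lebesgue_on \<Omega>)) | u G. mean_zero_pair \<Omega> u G}"
    (is "subspace ?W")
  unfolding subspace_def
proof (intro conjI ballI allI)
  have "mean_zero_pair \<Omega> (\<lambda>x. 0) (\<lambda>x. 0)"
    by (simp add: mean_zero_pair_iff has_H1_gradient_zero)
  then show "0 \<in> ?W" by (force simp: zero_prod_def zero_fun_def)
next
  fix x y assume "x \<in> ?W" "y \<in> ?W"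
  then obtain u G v K where u: "mean_zero_pair \<Omega> u G" "x = (G, \<integral>x. H x * u x \<partial>(lebesgue_on \<Omega>))"
    and v: "mean_zero_pair \<Omega> v K" "y = (K, \<integral>x. H x * v x \<partial>(lebesgue_on \<Omega>))"
    by auto
  have "mean_zero_pair \<Omega> (\<lambda>x. u x + v x) (\<lambda>x. G x + K x)"
    using u(1) v(1) mean_zero_pair_L2[OF u(1)] mean_zero_pair_L2[OF v(1)]
    by (simp add: mean_zero_pair_iff has_H1_gradient_add[OF \<Omega>] L2_integrable[OF \<Omega>])
  moreover have "x + y = (\<lambda>x. G x + K x, \<integral>x. H x * (u x + v x) \<partial>(lebesgue_on \<Omega>))"
    using u v mean_zero_pair_L2[OF u(1)] mean_zero_pair_L2[OF v(1)] H
    by (simp add: plus_fun_eq distrib_left L2_mult_integrable)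
  ultimately show "x + y \<in> ?W"
    by (intro CollectI exI[of _ "\<lambda>x. u x + v x"] exI[of _ "\<lambda>x. G x + K x"] conjI)
next
  fix x and c :: real assume "x \<in> ?W"
  then obtain u G where u: "mean_zero_pair \<Omega> u G" "x = (G, \<integral>x. H x * u x \<partial>(lebesgue_on \<Omega>))"
    by auto
  have "mean_zero_pair \<Omega> (\<lambda>x. c * u x) (\<lambda>x. c *\<^sub>R G x)"
    using u(1) by (simp add: mean_zero_pair_iff has_H1_gradient_scaleR)
  moreover have "c *\<^sub>R x = (\<lambda>x. c *\<^sub>R G x, \<integral>x. H x * (c * u x) \<partial>(lebesgue_on \<Omega>))"
    by (simp add: u(2) scaleR_fun_def mult.left_commute[of _ c])
  ultimately show "c *\<^sub>R x \<in> ?W"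
    by (intro CollectI exI[of _ "\<lambda>x. c * u x"] exI[of _ "\<lambda>x. c *\<^sub>R G x"] conjI)
qed

section \<open>Duality for the weighted least gradient problem\<close>

text \<open>The gap between a competitor and an admissible field is the integral of a pointwise Cauchy--Schwarz
defect: the constraint defining \<open>D0\<close> lets one add \<open>\<integral>(Du \<bullet> b + H u) = 0\<close> to the pairing \<open>\<integral>F \<bullet> b\<close>. Its
nonnegativity is weak duality, and its vanishing is the extremality relation.\<close>

lemma duality_defect:
  assumes F: "F \<in> L2 \<Omega>" and H: "H \<in> L2 \<Omega>" and a: "a \<in> L2 \<Omega>"
    and b: "b \<in> dual_admissible \<Omega> a H" and u: "mean_zero_pair \<Omega> u G"
  shows "primal_energy \<Omega> a F H u G - pairing \<Omega> F b
      = (\<integral>x. a x * norm (G x + F x) - (G x + F x) \<bullet> b x \<partial>(lebesgue_on \<Omega>))"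
    and "integrable (lebesgue_on \<Omega>) (\<lambda>x. a x * norm (G x + F x) - (G x + F x) \<bullet> b x)"
    and "AE x in lebesgue_on \<Omega>. 0 \<le> a x * norm (G x + F x) - (G x + F x) \<bullet> b x"
proof -
  have bL2: "b \<in> L2 \<Omega>" and ba: "AE x in lebesgue_on \<Omega>. norm (b x) \<le> a x"
    and b0: "(\<integral>x. G x \<bullet> b x + H x * u x \<partial>(lebesgue_on \<Omega>)) = 0"
    using b u by (auto simp: dual_admissible_def D0_def mean_zero_pair_def)
  note uG = mean_zero_pair_L2[OF u]
  have V: "(\<lambda>x. norm (G x + F x)) \<in> L2 \<Omega>"
    by (rule L2_norm[OF L2_add[OF uG(2) F]])
  note ints = L2_mult_integrable[OF a V] L2_mult_integrable[OF H uG(1)]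
    L2_inner_integrable[OF uG(2) bL2] L2_inner_integrable[OF F bL2]
  show "integrable (lebesgue_on \<Omega>) (\<lambda>x. a x * norm (G x + F x) - (G x + F x) \<bullet> b x)"
    using ints by (simp add: inner_add_left)
  show "primal_energy \<Omega> a F H u G - pairing \<Omega> F b
      = (\<integral>x. a x * norm (G x + F x) - (G x + F x) \<bullet> b x \<partial>(lebesgue_on \<Omega>))"
    using ints b0 by (simp add: primal_energy_def pairing_def inner_add_left)
  show "AE x in lebesgue_on \<Omega>. 0 \<le> a x * norm (G x + F x) - (G x + F x) \<bullet> b x"
    using ba
  proof eventually_elim
    case (elim x)
    have "(G x + F x) \<bullet> b x \<le> norm (G x + F x) * norm (b x)" by (rule norm_cauchy_schwarz)
    also have "\<dots> \<le> norm (G x + F x) * a x" using elim by (intro mult_left_mono) auto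
    finally show ?case by (simp add: mult.commute)
  qed
qed

lemma weak_duality:
  assumes "F \<in> L2 \<Omega>" "H \<in> L2 \<Omega>" "a \<in> L2 \<Omega>"
    and "b \<in> dual_admissible \<Omega> a H" and "mean_zero_pair \<Omega> u G"
  shows "pairing \<Omega> F b \<le> primal_energy \<Omega> a F H u G"
  using duality_defect(1)[OF assms] integral_nonneg_AE[OF duality_defect(3)[OF assms]] by simp

text \<open>If the defect vanishes, then \<open>V \<bullet> b = a \<bar>V\<bar>\<close> almost everywhere for \<open>V = Du + F\<close>. Where \<open>V \<noteq> 0\<close>, the
bound \<open>\<bar>b\<bar> \<le> a\<close> makes this the equality case of Cauchy--Schwarz, so \<open>b\<close> is \<open>a\<close> times the direction of \<open>V\<close>.\<close>

lemma equality_in_weak_duality: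
  assumes F: "F \<in> L2 \<Omega>" and H: "H \<in> L2 \<Omega>" and a: "a \<in> L2 \<Omega>"
    and b: "b \<in> dual_admissible \<Omega> a H" and u: "mean_zero_pair \<Omega> u G"
    and eq: "primal_energy \<Omega> a F H u G = pairing \<Omega> F b"
  shows "AE x in norm_measure \<Omega> (\<lambda>x. G x + F x).
    a x *\<^sub>R ((G x + F x) /\<^sub>R norm (G x + F x)) = b x"
proof -
  note defect = duality_defect[OF F H a b u]
  have "AE x in lebesgue_on \<Omega>. a x * norm (G x + F x) - (G x + F x) \<bullet> b x = 0"
    using integral_nonneg_eq_0_iff_AE[OF defect(2,3)] defect(1) eq by simp
  moreover have "AE x in lebesgue_on \<Omega>. norm (b x) \<le> a x"
    using b by (simp add: dual_admissible_def)
  ultimately have "AE x in lebesgue_on \<Omega>. G x + F x \<noteq> 0 \<longrightarrow>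
      a x *\<^sub>R ((G x + F x) /\<^sub>R norm (G x + F x)) = b x"
  proof eventually_elim
    case (elim x)
    define V where "V = G x + F x"
    show ?case
    proof
      assume "G x + F x \<noteq> 0"
      then have V: "V \<noteq> 0" by (simp add: V_def)
      define e where "e = V /\<^sub>R norm V"
      have e: "e \<bullet> e = 1" using V by (simp add: e_def power2_norm_eq_inner[symmetric] power2_eq_square)
      have Vb: "V \<bullet> b x = a x * norm V" using elim(1) by (simp add: V_def)
      have eb: "e \<bullet> b x = a x" using V by (simp add: e_def Vb)
      have "(norm (a x *\<^sub>R e - b x))\<^sup>2 = (a x)\<^sup>2 * (e \<bullet> e) - 2 * a x * (e \<bullet> b x) + (norm (b x))\<^sup>2"
        unfolding power2_norm_eq_inner
        by (simp add: inner_diff_left inner_diff_right inner_commute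
            power2_eq_square algebra_simps)
      also have "\<dots> = (norm (b x))\<^sup>2 - (a x)\<^sup>2" by (simp add: e eb power2_eq_square)
      also have "\<dots> \<le> 0" using elim(2) by (simp add: power_mono)
      finally show "a x *\<^sub>R ((G x + F x) /\<^sub>R norm (G x + F x)) = b x"
        by (simp add: e_def V_def)
    qed
  qed
  moreover have "(\<lambda>x. G x + F x) \<in> borel_measurable (lebesgue_on \<Omega>)"
    using L2_measurable[OF L2_add[OF mean_zero_pair_L2(2)[OF u] F]] .
  ultimately show ?thesis
    unfolding norm_measure_def by (subst AE_density) (auto elim: eventually_mono)
qed

text \<open>With the weighted measure \<open>\<mu> = a dx\<close> the functional \<open>V \<mapsto> \<integral>a\<bar>V\<bar>\<close> is the norm of \<open>L\<^sup>1(\<mu>)\<close>. Abstract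
duality gives a linear functional below this norm, and its representing field \<open>h\<close> with \<open>\<bar>h\<bar> \<le> 1\<close>
yields the dual solution \<open>N = a h\<close>.\<close>

lemma strong_duality:
  fixes F :: "real^'n \<Rightarrow> real^'n"
  assumes \<Omega>: "open \<Omega>" "bounded \<Omega>"
    and F: "F \<in> L2 \<Omega>" and H: "H \<in> L2 \<Omega>" and a: "a \<in> L2 \<Omega>"
    and a_pos: "AE x in lebesgue_on \<Omega>. 0 < a x"
    and lower: "\<And>u G. mean_zero_pair \<Omega> u G \<Longrightarrow> m \<le> primal_energy \<Omega> a F H u G"
  obtains N where "N \<in> dual_admissible \<Omega> a H" "m \<le> pairing \<Omega> F N"
proof -
  let ?M = "lebesgue_on \<Omega>"
  define \<mu> where "\<mu> = density ?M (\<lambda>x. ennreal (a x))"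
  have [measurable]: "a \<in> borel_measurable ?M" by (rule L2_measurable[OF a])
  have a_nonneg: "AE x in ?M. 0 \<le> a x" using a_pos by eventually_elim simp
  have finite: "finite_measure \<mu>"
  proof (rule finite_measureI)
    have "emeasure \<mu> (space \<mu>) = (\<integral>\<^sup>+x. ennreal (a x) * indicator (space ?M) x \<partial>?M)"
      unfolding \<mu>_def space_density by (rule emeasure_density) auto
    also have "\<dots> = (\<integral>\<^sup>+x. ennreal (a x) \<partial>?M)"
      by (rule nn_integral_cong) simp
    also have "\<dots> = ennreal (\<integral>x. a x \<partial>?M)"
      by (rule nn_integral_eq_integral[OF L2_integrable[OF \<Omega> a] a_nonneg])
    finally show "emeasure \<mu> (space \<mu>) \<noteq> \<infinity>" by simp
  qed
  have meas_\<mu>: "f \<in> borel_measurable \<mu> \<longleftrightarrow> f \<in> borel_measurable ?M" for f :: "real^'n \<Rightarrow> 'b::topological_space"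
    by (simp add: \<mu>_def)
  have L2_\<mu>: "integrable \<mu> V" if V: "V \<in> L2 \<Omega>" for V :: "real^'n \<Rightarrow> real^'n"
    using L2_scaleR_integrable[OF a V] L2_measurable[OF V] a_nonneg
    by (simp add: \<mu>_def integrable_density)
  have integral_\<mu>: "(\<integral>x. f x \<partial>\<mu>) = (\<integral>x. a x * f x \<partial>?M)" if "f \<in> borel_measurable ?M" for f :: "real^'n \<Rightarrow> real"
    using that a_nonneg by (simp add: \<mu>_def integral_density)
  define S where "S = {V :: real^'n \<Rightarrow> real^'n. integrable \<mu> V}"
  define p where "p V = (\<integral>x. norm (V x) \<partial>\<mu>)" for V :: "real^'n \<Rightarrow> real^'n"
  define W where "W = {(G, \<integral>x. H x * u x \<partial>?M) | u G. mean_zero_pair \<Omega> u G}"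
  have S: "subspace S" unfolding S_def by (rule subspace_integrable)
  have "sublinear_on S p"
    unfolding sublinear_on_def
  proof (intro conjI ballI allI impI)
    fix V V' assume "V \<in> S" "V' \<in> S"
    then have V: "integrable \<mu> V" "integrable \<mu> V'" by (auto simp: S_def)
    have "p (V + V') \<le> (\<integral>x. norm (V x) + norm (V' x) \<partial>\<mu>)"
      unfolding p_def using V by (intro integral_mono) (auto simp: plus_fun_eq norm_triangle_ineq)
    then show "p (V + V') \<le> p V + p V'" using V by (simp add: p_def)
  next
    fix V and c :: real assume "0 \<le> c"
    then show "p (c *\<^sub>R V) = c * p V" by (simp add: p_def scaleR_fun_def)
  qed
  moreover have "subspace W"
    unfolding W_def by (rule subspace_mean_zero_pairs[OF \<Omega> H])
  moreover have "F \<in> S" using L2_\<mu>[OF F] by (simp add: S_def)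
  moreover have WS: "G \<in> S" if "(G, r) \<in> W" for G r
    using that L2_\<mu> mean_zero_pair_L2(2) by (auto simp: S_def W_def)
  moreover have "m \<le> p (G + F) + r" if GW: "(G, r) \<in> W" for G r
  proof -
    obtain u where u: "mean_zero_pair \<Omega> u G" and r: "r = (\<integral>x. H x * u x \<partial>?M)"
      using GW by (auto simp: W_def)
    note uG = mean_zero_pair_L2[OF u]
    have V: "(\<lambda>x. norm (G x + F x)) \<in> L2 \<Omega>"
      by (rule L2_norm[OF L2_add[OF uG(2) F]])
    have "p (G + F) = (\<integral>x. a x * norm (G x + F x) \<partial>?M)"
      using L2_measurable[OF V] by (simp add: p_def plus_fun_eq integral_\<mu>)
    with lower[OF u] r show ?thesis
      by (simp add: primal_energy_def L2_mult_integrable[OF a V] L2_mult_integrable[OF H uG(1)])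
  qed
  ultimately obtain l where lin: "linear_functional_on S l" and lp: "\<And>V. V \<in> S \<Longrightarrow> l V \<le> p V"
    and lW: "\<And>G r. (G, r) \<in> W \<Longrightarrow> l G + r = 0" and lF: "m \<le> l F"
    using sublinear_duality[OF S, of p W F m] by blast
  obtain h where h: "h \<in> borel_measurable \<mu>" "AE x in \<mu>. norm (h x) \<le> 1"
    and l: "\<And>V. integrable \<mu> V \<Longrightarrow> l V = (\<integral>x. V x \<bullet> h x \<partial>\<mu>)"
    using L1_functional_representation[OF finite, of l] lin lp unfolding S_def p_def by blast
  have [measurable]: "h \<in> borel_measurable ?M" using h(1) by (simp add: meas_\<mu>)
  define N where "N x = a x *\<^sub>R h x" for x
  have N_meas: "N \<in> borel_measurable ?M" unfolding N_def by measurable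
  \<comment> \<open>Positivity of \<open>a\<close> turns a property holding \<open>\<mu>\<close>-a.e. into one holding Lebesgue-a.e.\<close>
  have "AE x in ?M. 0 < ennreal (a x) \<longrightarrow> norm (h x) \<le> 1"
    using h(2) unfolding \<mu>_def by (subst (asm) AE_density) auto
  then have Na: "AE x in ?M. norm (N x) \<le> a x"
    using a_pos
  proof eventually_elim
    case (elim x)
    then show ?case using mult_left_mono[of "norm (h x)" 1 "a x"] by (simp add: N_def)
  qed
  have NL2: "N \<in> L2 \<Omega>"
  proof (rule L2_dominated[OF N_meas a])
    show "AE x in ?M. norm (N x) \<le> norm (a x)" using Na by eventually_elim simp
  qed
  have lN: "l V = (\<integral>x. V x \<bullet> N x \<partial>?M)" if V: "V \<in> L2 \<Omega>" for V
  proof -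
    have [measurable]: "V \<in> borel_measurable ?M" by (rule L2_measurable[OF V])
    have "l V = (\<integral>x. a x * (V x \<bullet> h x) \<partial>?M)"
      by (simp add: l[OF L2_\<mu>[OF V]] integral_\<mu>)
    then show ?thesis by (simp add: N_def)
  qed
  have "(\<integral>x. G x \<bullet> N x + H x * u x \<partial>?M) = 0" if u: "mean_zero_pair \<Omega> u G" for u G
  proof -
    note uG = mean_zero_pair_L2[OF u]
    have "(G, \<integral>x. H x * u x \<partial>?M) \<in> W" using u by (auto simp: W_def)
    from lW[OF this] show ?thesis
      by (simp add: lN[OF uG(2)] L2_inner_integrable[OF uG(2) NL2] L2_mult_integrable[OF H uG(1)])
  qed
  then have "N \<in> dual_admissible \<Omega> a H"
    using NL2 Na by (auto simp: dual_admissible_def D0_def mean_zero_pair_def)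
  moreover have "m \<le> pairing \<Omega> F N" using lF lN[OF F] by (simp add: pairing_def)
  ultimately show ?thesis by (rule that)
qed

theorem theorem2p2:
  fixes \<Omega> :: "(real^'n) set"
    and F :: "real^'n \<Rightarrow> real^'n"
    and H a :: "real^'n \<Rightarrow> real"
  assumes "open \<Omega>" and "connected \<Omega>" and "\<Omega> \<noteq> {}" and "bounded \<Omega>"
    and "F \<in> L2 \<Omega>" and "H \<in> L2 \<Omega>"
    and "a \<in> L2 \<Omega>" and "AE x in lebesgue_on \<Omega>. 0 < a x"
  shows "primal_value \<Omega> a F H = dual_value \<Omega> a F H \<and>
    (primal_value \<Omega> a F H \<noteq> -\<infinity> \<longrightarrow>
      (\<exists>N \<in> D0 \<Omega> H. (AE x in lebesgue_on \<Omega>. norm (N x) \<le> a x) \<and>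
         primal_value \<Omega> a F H = ereal (pairing \<Omega> F N) \<and>
         (\<forall>u Du. primal_minimizer \<Omega> a F H u Du \<longrightarrow>
            (AE x in norm_measure \<Omega> (\<lambda>x. Du x + F x).
               a x *\<^sub>R ((Du x + F x) /\<^sub>R norm (Du x + F x)) = N x))))"
proof -
  note [simp] = \<open>F \<in> L2 \<Omega>\<close> \<open>H \<in> L2 \<Omega>\<close> \<open>a \<in> L2 \<Omega>\<close>
  let ?P = "primal_value \<Omega> a F H" and ?D = "dual_value \<Omega> a F H"
  have P: "?P = Inf {ereal (primal_energy \<Omega> a F H u G) | u G. mean_zero_pair \<Omega> u G}"
    by (simp add: primal_value_def mean_zero_pair_def)
  have P_le: "?P \<le> ereal (primal_energy \<Omega> a F H u G)" if "mean_zero_pair \<Omega> u G" for u G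
    unfolding P using that by (intro Inf_lower) blast
  have weak: "?D \<le> ?P"
    unfolding dual_value_def P by (intro SUP_least Inf_greatest) (auto intro!: weak_duality[OF assms(5-7)])
  show ?thesis
  proof (cases "?P = - \<infinity>")
    case True
    with weak show ?thesis by simp
  next
    case False
    have "?P \<noteq> \<infinity>"
      using P_le[of "\<lambda>x. 0" "\<lambda>x. 0"] by (auto simp: mean_zero_pair_iff has_H1_gradient_zero)
    with False obtain m where m: "?P = ereal m" by (cases ?P) auto
    have "m \<le> primal_energy \<Omega> a F H u G" if "mean_zero_pair \<Omega> u G" for u G
      using P_le[OF that] m by simp
    then obtain N where N: "N \<in> dual_admissible \<Omega> a H" and mN: "m \<le> pairing \<Omega> F N"
      using strong_duality[OF assms(1,4-8)] by blast
    have ND: "ereal (pairing \<Omega> F N) \<le> ?D"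
      unfolding dual_value_def using N by (rule SUP_upper)
    have PN: "?P \<le> ereal (pairing \<Omega> F N)" using m mN by simp
    have PD: "?P = ?D"
      by (rule antisym[OF order_trans[OF PN ND] weak])
    have eq: "?P = ereal (pairing \<Omega> F N)"
      by (rule antisym[OF PN order_trans[OF ND weak]])
    have extremal: "AE x in norm_measure \<Omega> (\<lambda>x. Du x + F x).
        a x *\<^sub>R ((Du x + F x) /\<^sub>R norm (Du x + F x)) = N x"
      if min: "primal_minimizer \<Omega> a F H u Du" for u Du
    proof -
      have u: "mean_zero_pair \<Omega> u Du" using min by (simp add: primal_minimizer_def mean_zero_pair_def)
      have "ereal (primal_energy \<Omega> a F H u Du) \<le> ?P"
        unfolding P using min
        by (intro Inf_greatest) (auto simp: primal_minimizer_def mean_zero_pair_def)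
      with P_le[OF u] eq have "primal_energy \<Omega> a F H u Du = pairing \<Omega> F N" by simp
      then show ?thesis using N u by (intro equality_in_weak_duality) auto
    qed
    have N_D0: "N \<in> D0 \<Omega> H" and N_le: "AE x in lebesgue_on \<Omega>. norm (N x) \<le> a x"
      using N by (simp_all add: dual_admissible_def)
    show ?thesis
    proof (intro conjI impI)
      show "?P = ?D" by (rule PD)
      show "\<exists>N \<in> D0 \<Omega> H. (AE x in lebesgue_on \<Omega>. norm (N x) \<le> a x) \<and>
         ?P = ereal (pairing \<Omega> F N) \<and>
         (\<forall>u Du. primal_minimizer \<Omega> a F H u Du \<longrightarrow>
            (AE x in norm_measure \<Omega> (\<lambda>x. Du x + F x).
               a x *\<^sub>R ((Du x + F x) /\<^sub>R norm (Du x + F x)) = N x))"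
      proof (rule bexI[OF _ N_D0], intro conjI allI impI)
        fix u Du assume "primal_minimizer \<Omega> a F H u Du"
        then show "AE x in norm_measure \<Omega> (\<lambda>x. Du x + F x).
            a x *\<^sub>R ((Du x + F x) /\<^sub>R norm (Du x + F x)) = N x"
          by (rule extremal)
      qed (fact N_le, fact eq)
    qed
  qed
qed

end
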